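(* Di-LoMuF admits a polynomial-time 2-approximation algorithm on symmetric di-trees. That is, there is a polynomial-time algorithm which, given a symmetric di-tree $G$ and supply vectors $\vec{s}_1,\dots,\vec{s}_k$, outputs $v_1,\dots,v_k$ with $\lambda(G;\vec{s}_1\circ v_1,\dots,\vec{s}_k\circ v_k)\ge\frac12\lambda(G;\vec{s}_1,\dots,\vec{s}_k)$.
   Context: A capacitated directed graph is $G=(V,A,\vec{c})$ with $\vec{c}\in\mathbb{R}_+^A$. Flows are $\vec{f}\in\mathbb{R}_+^A$. A flow satisfies a zero-sum demand vector $\vec{d}\in\mathbb{R}^V$ if at each $v$ the inflow minus outflow equals $\vec{d}(v)$. A family is valid if $\sum_i\vec{f}_i(a)\le\vec{c}(a)$ for every arc $a$. $\lambda(G;\vec{d}_1,\dots,\vec{d}_k)$ is the largest $\lambda\ge0$ such that a valid family has $\vec{f}_i$ satisfying $\lambda\vec{d}_i$ for all $i$. A supply vector is $\vec{s}\in\mathbb{R}_-^V$. $\vec{s}\circ v$ equals $\vec{s}(u)$ at $u\ne v$ and $-\sum_{w\ne v}\vec{s}(w)$ at $v$. Di-LoMuF: find $v_1,\dots,v_k\in V$ maximizing $\lambda(G;\vec{s}_1\circ v_1,\dots,\vec{s}_k\circ v_k)$. The optimum value is denoted $\lambda(G;\vec{s}_1,\dots,\vec{s}_k)$. A di-tree is a directed graph that becomes an undirected tree after removing arc directions and merging multi-edges. It is symmetric if all arcs have equal capacity and $(v,u)\in A$ whenever $(u,v)\in A$. *)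

theory Defs
  imports
    Complex_Main
    "HOL-Library.Extended_Real"
    "HOL-Library.Log_Nat"
    "HOL-Computational_Algebra.Polynomial"
    "Graph_Theory.Pair_Digraph"
begin

section \<open>Flows and the location problem\<close>

text \<open>A capacitated digraph is a pair-digraph together with a capacity function on its arcs.
  Values of capacities and flows outside \<open>parcs G\<close>, and of demands and supplies outside
  \<open>pverts G\<close>, are irrelevant.\<close>

definition flow :: "'v pair_pre_digraph \<Rightarrow> ('v \<times> 'v \<Rightarrow> real) \<Rightarrow> bool" where
  "flow G f \<longleftrightarrow> (\<forall>a \<in> parcs G. 0 \<le> f a)"

definition satisfies_demand ::
    "'v pair_pre_digraph \<Rightarrow> ('v \<times> 'v \<Rightarrow> real) \<Rightarrow> ('v \<Rightarrow> real) \<Rightarrow> bool" where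
  "satisfies_demand G f d \<longleftrightarrow>
     (\<forall>v \<in> pverts G. sum f (in_arcs (with_proj G) v) - sum f (out_arcs (with_proj G) v) = d v)"

definition valid_family ::
    "'v pair_pre_digraph \<Rightarrow> ('v \<times> 'v \<Rightarrow> real) \<Rightarrow> ('v \<times> 'v \<Rightarrow> real) list \<Rightarrow> bool" where
  "valid_family G c fs \<longleftrightarrow> (\<forall>a \<in> parcs G. (\<Sum>f\<leftarrow>fs. f a) \<le> c a)"

text \<open>The largest feasible scaling factor. It is taken as a supremum of extended reals because
  it is infinite when all demands vanish (e.g. when there is no commodity at all).\<close>

definition flow_lambda ::
    "'v pair_pre_digraph \<Rightarrow> ('v \<times> 'v \<Rightarrow> real) \<Rightarrow> ('v \<Rightarrow> real) list \<Rightarrow> ereal" where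
  "flow_lambda G c ds = Sup {ereal l | l. 0 \<le> l \<and>
     (\<exists>fs. length fs = length ds \<and> (\<forall>f \<in> set fs. flow G f) \<and> valid_family G c fs \<and>
       (\<forall>i < length ds. satisfies_demand G (fs ! i) (\<lambda>v. l * (ds ! i) v)))}"

definition supply_vector :: "'v pair_pre_digraph \<Rightarrow> ('v \<Rightarrow> real) \<Rightarrow> bool" where
  "supply_vector G s \<longleftrightarrow> (\<forall>v \<in> pverts G. s v \<le> 0)"

definition route_to :: "'v pair_pre_digraph \<Rightarrow> ('v \<Rightarrow> real) \<Rightarrow> 'v \<Rightarrow> 'v \<Rightarrow> real" where
  "route_to G s v = s(v := - (\<Sum>w \<in> pverts G - {v}. s w))"

definition lomuf_value ::
    "'v pair_pre_digraph \<Rightarrow> ('v \<times> 'v \<Rightarrow> real) \<Rightarrow> ('v \<Rightarrow> real) list \<Rightarrow> 'v list \<Rightarrow> ereal" where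
  "lomuf_value G c ss vs = flow_lambda G c (map2 (route_to G) ss vs)"

definition lomuf_opt ::
    "'v pair_pre_digraph \<Rightarrow> ('v \<times> 'v \<Rightarrow> real) \<Rightarrow> ('v \<Rightarrow> real) list \<Rightarrow> ereal" where
  "lomuf_opt G c ss =
     (SUP vs \<in> {vs. length vs = length ss \<and> set vs \<subseteq> pverts G}. lomuf_value G c ss vs)"


section \<open>Symmetric di-trees\<close>

definition underlying_edges :: "'v pair_pre_digraph \<Rightarrow> 'v set set" where
  "underlying_edges G = {{u, v} | u v. (u, v) \<in> parcs G}"

definition undirected_cycle :: "'v set set \<Rightarrow> 'v list \<Rightarrow> bool" where
  "undirected_cycle E p \<longleftrightarrow> 3 \<le> length p \<and> distinct p \<and>
     (\<forall>i < length p. {p ! i, p ! (Suc i mod length p)} \<in> E)"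

definition undirected_tree :: "'v set \<Rightarrow> 'v set set \<Rightarrow> bool" where
  "undirected_tree V E \<longleftrightarrow> finite V \<and> V \<noteq> {} \<and> (\<forall>e \<in> E. e \<subseteq> V \<and> card e = 2) \<and>
     (\<forall>u \<in> V. \<forall>v \<in> V. (u, v) \<in> {(x, y). {x, y} \<in> E}\<^sup>*) \<and> (\<nexists>p. undirected_cycle E p)"

definition di_tree :: "'v pair_pre_digraph \<Rightarrow> bool" where
  "di_tree G \<longleftrightarrow> pair_wf_digraph G \<and> undirected_tree (pverts G) (underlying_edges G)"

definition symmetric_di_tree :: "'v pair_pre_digraph \<Rightarrow> ('v \<times> 'v \<Rightarrow> real) \<Rightarrow> bool" where
  "symmetric_di_tree G c \<longleftrightarrow>
     di_tree G \<and> sym (parcs G) \<and> (\<forall>a \<in> parcs G. \<forall>b \<in> parcs G. c a = c b)"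


section \<open>Random access machine with logarithmic cost\<close>

text \<open>The machine model is the random access machine of Cook and Reckhow with the logarithmic cost
  criterion (every integer that is handled, addresses included, is charged its bit length), in the
  instruction set with multiplication; polynomial time in this model is polynomial time on Turing
  machines. Programs are written with structured control instead of jumps. The memory is
  infinite in both directions: non-negative addresses hold input and output, negative addresses
  initially hold 0.\<close>

type_synonym memory = "int \<Rightarrow> int"

datatype exp = Const int | Load exp | Add exp exp | Sub exp exp | Mul exp exp

datatype prog =
    Skip
  | Store exp exp
  | Seq prog prog
  | IfPos exp prog prog
  | WhilePos exp prog

text \<open>Sign plus binary digits of the absolute value.\<close>

definition int_size :: "int \<Rightarrow> nat" where
  "int_size z = 1 + floorlog 2 (nat \<bar>z\<bar>)"

fun val :: "exp \<Rightarrow> memory \<Rightarrow> int" where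
  "val (Const z) m = z"
| "val (Load e) m = m (val e m)"
| "val (Add e1 e2) m = val e1 m + val e2 m"
| "val (Sub e1 e2) m = val e1 m - val e2 m"
| "val (Mul e1 e2) m = val e1 m * val e2 m"

fun val_cost :: "exp \<Rightarrow> memory \<Rightarrow> nat" where
  "val_cost (Const z) m = int_size z"
| "val_cost (Load e) m = val_cost e m + int_size (val (Load e) m)"
| "val_cost (Add e1 e2) m = val_cost e1 m + val_cost e2 m + int_size (val (Add e1 e2) m)"
| "val_cost (Sub e1 e2) m = val_cost e1 m + val_cost e2 m + int_size (val (Sub e1 e2) m)"
| "val_cost (Mul e1 e2) m = val_cost e1 m + val_cost e2 m + int_size (val (Mul e1 e2) m)"

text \<open>\<open>exec p m t m'\<close>: started with memory \<open>m\<close>, program \<open>p\<close> halts at cost \<open>t\<close> with memory \<open>m'\<close>.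
  \<open>Store a e\<close> writes the value of \<open>e\<close> to the address given by the value of \<open>a\<close>; the tests
  check whether the value of the expression is positive.\<close>

inductive exec :: "prog \<Rightarrow> memory \<Rightarrow> nat \<Rightarrow> memory \<Rightarrow> bool" where
  Skip: "exec Skip m 1 m"
| Store: "exec (Store a e) m (1 + val_cost a m + val_cost e m) (m(val a m := val e m))"
| Seq: "exec p m t m' \<Longrightarrow> exec q m' t' m'' \<Longrightarrow> exec (Seq p q) m (t + t') m''"
| IfPos_true: "val e m > 0 \<Longrightarrow> exec p m t m' \<Longrightarrow> exec (IfPos e p q) m (1 + val_cost e m + t) m'"
| IfPos_false: "val e m \<le> 0 \<Longrightarrow> exec q m t m' \<Longrightarrow> exec (IfPos e p q) m (1 + val_cost e m + t) m'"
| WhilePos_false: "val e m \<le> 0 \<Longrightarrow> exec (WhilePos e p) m (1 + val_cost e m) m"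
| WhilePos_true: "val e m > 0 \<Longrightarrow> exec p m t m' \<Longrightarrow> exec (WhilePos e p) m' t' m'' \<Longrightarrow>
    exec (WhilePos e p) m (1 + val_cost e m + t + t') m''"

inductive_cases exec_SkipE: "exec Skip m t m'"
inductive_cases exec_StoreE: "exec (Store a e) m t m'"
inductive_cases exec_SeqE: "exec (Seq p q) m t m'"
inductive_cases exec_IfPosE: "exec (IfPos e p q) m t m'"
inductive_cases exec_WhilePosE: "exec (WhilePos e p) m t m'"

lemma exec_deterministic:
  assumes "exec p m t m1" and "exec p m u m2"
  shows "t = u \<and> m1 = m2"
  using assms
proof (induction arbitrary: u m2 rule: exec.induct)
  case (Skip m)
  then show ?case by (auto elim: exec_SkipE)
next
  case (Store a e m)
  then show ?case by (auto elim: exec_StoreE)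
next
  case (Seq p m t m' q t' m'')
  from Seq.prems Seq.IH show ?case by (blast elim: exec_SeqE)
next
  case (IfPos_true e m p t m' q)
  from IfPos_true.prems IfPos_true.hyps(1) IfPos_true.IH show ?case
    by (fastforce elim: exec_IfPosE)
next
  case (IfPos_false e m q t m' p)
  from IfPos_false.prems IfPos_false.hyps(1) IfPos_false.IH show ?case
    by (fastforce elim: exec_IfPosE)
next
  case (WhilePos_false e m p)
  from WhilePos_false.prems WhilePos_false.hyps(1) show ?case
    by (auto elim: exec.cases)
next
  case (WhilePos_true e m p t m' t' m'')
  from WhilePos_true.prems WhilePos_true.hyps(1) WhilePos_true.IH show ?case
    by (cases rule: exec.cases) (auto dest!: WhilePos_true.IH)
qed

text \<open>A list of words is stored in memory as its length in cell 0 followed by its elements in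
  cells 1, 2, and so on.\<close>

definition input_memory :: "int list \<Rightarrow> memory" where
  "input_memory xs = (\<lambda>i. if i = 0 then int (length xs)
     else if 1 \<le> i \<and> i \<le> int (length xs) then xs ! nat (i - 1) else 0)"

definition output_words :: "memory \<Rightarrow> int list" where
  "output_words m = map m [1..m 0]"

definition outputs :: "prog \<Rightarrow> int list \<Rightarrow> int list \<Rightarrow> bool" where
  "outputs p xs ys \<longleftrightarrow> (\<exists>t m. exec p (input_memory xs) t m \<and> output_words m = ys)"

definition input_size :: "int list \<Rightarrow> nat" where
  "input_size xs = (\<Sum>x\<leftarrow>xs. int_size x)"

definition polynomial_time_on :: "prog \<Rightarrow> int list set \<Rightarrow> bool" where
  "polynomial_time_on p X \<longleftrightarrow> (\<exists>B :: nat poly. \<forall>xs \<in> X. \<exists>t m.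
     exec p (input_memory xs) t m \<and> t \<le> poly B (input_size xs))"


section \<open>Problem instances and their encoding\<close>

text \<open>As usual for algorithms on finite inputs, the numbers of an instance are rational; flows and
  optimum values are real nevertheless. The vertices are \<open>0, \<dots>, num_verts - 1\<close>, and the arcs are
  listed in an arbitrary order.\<close>

record lomuf_instance =
  num_verts :: nat
  arc_list :: "(nat \<times> nat) list"
  capacity :: "nat \<times> nat \<Rightarrow> rat"
  supplies :: "(nat \<Rightarrow> rat) list"

definition inst_graph :: "lomuf_instance \<Rightarrow> nat pair_pre_digraph" where
  "inst_graph I = \<lparr>pverts = {..<num_verts I}, parcs = set (arc_list I)\<rparr>"

definition inst_cap :: "lomuf_instance \<Rightarrow> nat \<times> nat \<Rightarrow> real" where
  "inst_cap I a = real_of_rat (capacity I a)"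

definition inst_supplies :: "lomuf_instance \<Rightarrow> (nat \<Rightarrow> real) list" where
  "inst_supplies I = map (\<lambda>s v. real_of_rat (s v)) (supplies I)"

definition well_formed_instance :: "lomuf_instance \<Rightarrow> bool" where
  "well_formed_instance I \<longleftrightarrow> pair_wf_digraph (inst_graph I) \<and> distinct (arc_list I) \<and>
     (\<forall>a \<in> parcs (inst_graph I). 0 \<le> inst_cap I a) \<and>
     (\<forall>s \<in> set (inst_supplies I). supply_vector (inst_graph I) s)"

definition encode_rat :: "rat \<Rightarrow> int list" where
  "encode_rat r = [fst (quotient_of r), snd (quotient_of r)]"

definition encode_instance :: "lomuf_instance \<Rightarrow> int list" where
  "encode_instance I =
     [int (num_verts I), int (length (arc_list I)), int (length (supplies I))] @
     concat (map (\<lambda>a. [int (fst a), int (snd a)] @ encode_rat (capacity I a)) (arc_list I)) @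
     concat (map (\<lambda>s. concat (map (\<lambda>v. encode_rat (s v)) [0..<num_verts I])) (supplies I))"

definition symmetric_di_tree_instances :: "lomuf_instance set" where
  "symmetric_di_tree_instances =
     {I. well_formed_instance I \<and> symmetric_di_tree (inst_graph I) (inst_cap I)}"

end

theory Submission
  imports Defs
begin

text \<open>The algorithm routes every commodity to a weighted centroid of its supplies: a vertex all of
  whose branches carry at most half of the total supply. Across an edge that splits the supply of
  commodity \<open>i\<close> into \<open>a\<^sub>i\<close> and \<open>b\<^sub>i\<close>, a centroid makes only \<open>min a\<^sub>i b\<^sub>i\<close> flow, whereas any choice of
  sinks makes at least that much flow, in one direction or the other. Both directions of the edge
  together have only twice the capacity of one, which costs the factor 2. A centroid is found as the
  tail of an arc whose tail side carries more than half of the supply and has as few vertices as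
  possible; if there is no such arc, every vertex is a centroid.\<close>

section \<open>The two sides of an arc of a tree\<close>

text \<open>The lower bound comes from a cut. Flow conservation fixes only the difference of the
  flows on the two arcs of an edge; flows are nonnegative, so their sum is at least the absolute
  value of that difference. Call a side heavy if it carries more than half of the supply. Minimising
  the number of vertices works because every branch at the tail of a smallest heavy side, other than
  the one through its head, is a strictly smaller side and hence not heavy. The obstacle on the
  machine is the logarithmic cost, since rational supplies have to be added exactly. The running sum
  is an unreduced fraction \<open>p / q\<close>, and \<open>\<bar>p\<bar> + q\<close> stays below
  the product of all \<open>\<bar>num\<bar> + den\<close>, whose bit length the input pays for.
  Hence the single number \<open>2 ^ bits\<close> bounds every memory cell during the whole run, and
  counting loop iterations gives the time bound. Sides are defined by reachability because this is
  what rounds of marking compute; the proof about the program then knows nothing of trees until its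
  results are interpreted.\<close>

definition side :: "('v \<times> 'v) set \<Rightarrow> 'v \<Rightarrow> 'v \<Rightarrow> 'v set" where
  "side E u v = {(x, y) \<in> E. y \<noteq> v}\<^sup>* `` {u}"

lemma side_self: "u \<in> side E u v"
  by (simp add: side_def)

lemma side_step: "x \<in> side E u v \<Longrightarrow> (x, y) \<in> E \<Longrightarrow> y \<noteq> v \<Longrightarrow> y \<in> side E u v"
  by (auto simp: side_def intro: rtrancl_into_rtrancl)

lemma side_induct [consumes 1, case_names self step]:
  assumes "y \<in> side E u v"
    and "P u"
    and "\<And>y z. y \<in> side E u v \<Longrightarrow> P y \<Longrightarrow> (y, z) \<in> E \<Longrightarrow> z \<noteq> v \<Longrightarrow> P z"
  shows "P y"
proof -
  have "(u, y) \<in> {(x, y) \<in> E. y \<noteq> v}\<^sup>*"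
    using assms(1) by (simp add: side_def)
  then show ?thesis
    by (induction rule: rtrancl_induct) (use assms(2,3) in \<open>auto simp: side_def\<close>)
qed

lemma avoided_notin_side: "u \<noteq> v \<Longrightarrow> v \<notin> side E u v"
  using side_induct[of v E u v "\<lambda>y. y \<noteq> v"] by blast

lemma side_trans: "x \<in> side E u v \<Longrightarrow> y \<in> side E x v \<Longrightarrow> y \<in> side E u v"
  by (auto simp: side_def)

text \<open>If the new vertex is already on the path, the path is truncated there. This provides the
  distinct list that \<open>undirected_cycle\<close> asks for.\<close>

lemma rtrancl_imp_simple_path:
  assumes "(x, y) \<in> r\<^sup>*"
  shows "\<exists>p. p \<noteq> [] \<and> hd p = x \<and> last p = y \<and> distinct p \<and>
    (\<forall>i. Suc i < length p \<longrightarrow> (p ! i, p ! Suc i) \<in> r)"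
  using assms
proof (induction rule: rtrancl_induct)
  case base
  show ?case by (rule exI[of _ "[x]"]) simp
next
  case (step y z)
  then obtain p where p: "p \<noteq> []" "hd p = x" "last p = y" "distinct p"
    and steps: "\<And>i. Suc i < length p \<Longrightarrow> (p ! i, p ! Suc i) \<in> r" by blast
  show ?case
  proof (cases "z \<in> set p")
    case True
    then obtain as bs where asbs: "p = as @ z # bs" by (meson split_list)
    have "((as @ [z]) ! i, (as @ [z]) ! Suc i) \<in> r" if "Suc i < length (as @ [z])" for i
      using steps[of i] that by (auto simp: asbs nth_append split: if_splits)
    moreover have "hd (as @ [z]) = x" "distinct (as @ [z])"
      using p asbs by (auto simp: hd_append)
    ultimately show ?thesis
      by (intro exI[of _ "as @ [z]"]) simp
  next
    case False
    have "((p @ [z]) ! i, (p @ [z]) ! Suc i) \<in> r" if "Suc i < length (p @ [z])" for i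
    proof (cases "Suc i < length p")
      case True
      then show ?thesis using steps by (simp add: nth_append)
    next
      case False
      with that have "i = length p - 1" "Suc i = length p" by auto
      then show ?thesis using p step.hyps(2) by (auto simp: nth_append last_conv_nth)
    qed
    with False p show ?thesis by (intro exI[of _ "p @ [z]"]) simp
  qed
qed

text \<open>A bare vertex set with a relation, so that it can be interpreted both for the vertices
  and arcs of a digraph and for the arc list of an encoded instance.\<close>

locale symmetric_tree =
  fixes V :: "'v set" and E :: "('v \<times> 'v) set"
  assumes finite_V: "finite V"
    and E_sub: "E \<subseteq> V \<times> V"
    and sym_E: "sym E"
    and loop_free: "(x, x) \<notin> E"
    and connected: "x \<in> V \<Longrightarrow> y \<in> V \<Longrightarrow> (x, y) \<in> E\<^sup>*"
    and acyclic: "\<not> undirected_cycle {{u, v} | u v. (u, v) \<in> E} p"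
begin

lemma E_commute: "(x, y) \<in> E \<Longrightarrow> (y, x) \<in> E"
  using sym_E by (auto dest: symD)

lemma E_neq: "(x, y) \<in> E \<Longrightarrow> x \<noteq> y"
  using loop_free by blast

lemma E_in_V: "(x, y) \<in> E \<Longrightarrow> x \<in> V \<and> y \<in> V"
  using E_sub by blast

lemma finite_E: "finite E"
  using finite_subset[OF E_sub] finite_V by blast

lemma side_subset: "u \<in> V \<Longrightarrow> side E u v \<subseteq> V"
proof
  fix x assume "u \<in> V" "x \<in> side E u v"
  from this(2) show "x \<in> V"
    by (induction rule: side_induct) (use \<open>u \<in> V\<close> E_in_V in auto)
qed

lemma finite_side: "u \<in> V \<Longrightarrow> finite (side E u v)"
  using side_subset finite_V finite_subset by metis

text \<open>The walk is reversed. The reversed walk enters \<open>u\<close>, which the original one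
  only started from; this is allowed because \<open>u \<noteq> v\<close>.\<close>

lemma side_commute:
  assumes "y \<in> side E u v" "u \<noteq> v"
  shows "u \<in> side E y v"
  using assms(1)
proof (induction rule: side_induct)
  case self
  show ?case by (rule side_self)
next
  case (step y z)
  have "y \<noteq> v" using step.hyps(1) avoided_notin_side assms(2) by metis
  then have "y \<in> side E z v" using step.hyps E_commute side_step side_self by metis
  then show ?case using step.IH side_trans by metis
qed

text \<open>If the two branches met, a simple path from \<open>u\<close> to \<open>w\<close> would
  avoid \<open>v\<close>, and \<open>v\<close> would close it to a cycle. This is the only use of
  acyclicity.\<close>

lemma sides_disjoint:
  assumes u: "(u, v) \<in> E" and w: "(w, v) \<in> E" and "u \<noteq> w"
  shows "side E u v \<inter> side E w v = {}"
proof (rule ccontr)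
  assume "side E u v \<inter> side E w v \<noteq> {}"
  then have "w \<in> side E u v"
    using side_commute side_trans w E_neq by (metis disjoint_iff)
  then have "(u, w) \<in> {(x, y) \<in> E. y \<noteq> v}\<^sup>*" by (simp add: side_def)
  from rtrancl_imp_simple_path[OF this]
  obtain p where p: "p \<noteq> []" "hd p = u" "last p = w" "distinct p"
    and steps: "\<And>i. Suc i < length p \<Longrightarrow> (p ! i, p ! Suc i) \<in> {(x, y) \<in> E. y \<noteq> v}"
    by blast
  have p0: "p ! 0 = u" "p ! (length p - 1) = w"
    using p by (simp_all add: hd_conv_nth last_conv_nth)
  have len: "2 \<le> length p"
    using p(1-3) \<open>u \<noteq> w\<close> by (cases p; cases "tl p") auto
  have "p ! i \<noteq> v" if "i < length p" for i
  proof (cases i)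
    case 0
    then show ?thesis using p0 u E_neq by auto
  next
    case (Suc j)
    then show ?thesis using steps[of j] that by auto
  qed
  then have "v \<notin> set p" by (metis in_set_conv_nth)
  have "{(v # p) ! i, (v # p) ! (Suc i mod length (v # p))} \<in> {{u, v} | u v. (u, v) \<in> E}"
    if i: "i < length (v # p)" for i
  proof -
    \<comment> \<open>The edge from \<open>v\<close> to \<open>u\<close>, an edge of the path, and
      the closing edge from \<open>w\<close> to \<open>v\<close>, where the successor index wraps
      around to 0.\<close>
    consider "i = 0" | j where "i = Suc j" "Suc j < length p" | "i = length p"
      using i by (cases i) (auto simp: less_Suc_eq)
    then show ?thesis
    proof cases
      case 1
      then show ?thesis using len p0 E_commute[OF u] by auto
    next
      case 2
      then show ?thesis using steps[of j] by auto
    next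
      case 3
      then show ?thesis using len p0 w by (auto simp: nth_Cons')
    qed
  qed
  then have "undirected_cycle {{u, v} | u v. (u, v) \<in> E} (v # p)"
    unfolding undirected_cycle_def using len p(4) \<open>v \<notin> set p\<close> by auto
  then show False using acyclic by blast
qed

lemma sides_cover:
  assumes "x \<in> V" "y \<in> V" "y \<noteq> x"
  obtains u where "(u, x) \<in> E" "y \<in> side E u x"
proof -
  have "y = x \<or> (\<exists>u. (u, x) \<in> E \<and> y \<in> side E u x)"
    using connected[OF assms(1,2)]
  proof (induction rule: rtrancl_induct)
    case (step y z)
    then show ?case by (metis E_commute side_step side_self)
  qed simp
  then show ?thesis using that assms(3) by blast
qed

text \<open>A walk from \<open>v\<close> that avoids \<open>u\<close> stays in \<open>v\<close> and
  its branches other than that of \<open>u\<close>, and these are disjoint from it. Conversely, such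
  a branch does not contain \<open>u\<close>, so a walk inside it can be prefixed with the step from
  \<open>v\<close>.\<close>

lemma side_opposite:
  assumes "(u, v) \<in> E"
  shows "side E v u = V - side E u v"
proof
  have uv: "u \<in> V" "v \<in> V" "u \<noteq> v" using assms E_in_V E_neq by auto
  have *: "y = v \<or> (\<exists>w. (w, v) \<in> E \<and> w \<noteq> u \<and> y \<in> side E w v)" if "y \<in> side E v u" for y
    using that
  proof (induction rule: side_induct)
    case (step y z)
    then show ?case by (metis E_commute side_step side_self)
  qed simp
  show "side E v u \<subseteq> V - side E u v"
  proof
    fix y assume y: "y \<in> side E v u"
    then have "y \<in> V" using side_subset uv by blast
    moreover have "y \<notin> side E u v"
      using *[OF y] sides_disjoint[OF assms] avoided_notin_side[OF uv(3)] by fastforce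
    ultimately show "y \<in> V - side E u v" by simp
  qed
  show "V - side E u v \<subseteq> side E v u"
  proof
    fix y assume y: "y \<in> V - side E u v"
    show "y \<in> side E v u"
    proof (cases "y = v")
      case True
      then show ?thesis by (simp add: side_self)
    next
      case False
      then obtain w where w: "(w, v) \<in> E" "y \<in> side E w v"
        using sides_cover uv y by blast
      then have "w \<noteq> u" using y by auto
      then have "u \<notin> side E w v"
        using sides_disjoint[OF assms w(1)] side_self[of u E v] by blast
      from w(2) show ?thesis
      proof (induction rule: side_induct)
        case self
        then show ?case using E_commute[OF w(1)] \<open>w \<noteq> u\<close> side_step side_self by metis
      next
        case (step y z)
        then have "z \<noteq> u" using \<open>u \<notin> side E w v\<close> side_step by metis
        then show ?case using step side_step by metis
      qed
    qed
  qed
qed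

text \<open>A side can only be left into \<open>v\<close>, and from no vertex but \<open>u\<close>:
  another neighbour \<open>x\<close> of \<open>v\<close> in the side would make the branches of
  \<open>u\<close> and \<open>x\<close> meet.\<close>

lemma crossing_arcs:
  assumes "(u, v) \<in> E" "(x, y) \<in> E"
  shows "x \<in> side E u v \<and> y \<notin> side E u v \<longleftrightarrow> (x, y) = (u, v)"
    and "x \<notin> side E u v \<and> y \<in> side E u v \<longleftrightarrow> (x, y) = (v, u)"
proof -
  have *: "(x, y) = (u, v)" if "(x, y) \<in> E" "x \<in> side E u v" "y \<notin> side E u v" for x y
  proof -
    have "y = v" using that side_step by metis
    moreover from this have "x = u"
      using that sides_disjoint[OF assms(1), of x] side_self[of x E v] by blast
    ultimately show ?thesis by simp
  qed
  have "v \<notin> side E u v" using assms(1) E_neq avoided_notin_side by metis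
  moreover have "u \<in> side E u v" by (rule side_self)
  moreover have "(y, x) \<in> E" using assms(2) by (rule E_commute)
  ultimately show "x \<in> side E u v \<and> y \<notin> side E u v \<longleftrightarrow> (x, y) = (u, v)"
    and "x \<notin> side E u v \<and> y \<in> side E u v \<longleftrightarrow> (x, y) = (v, u)"
    using *[of x y] *[of y x] assms(2) by blast+
qed

lemma sum_sides:
  fixes g :: "'v \<Rightarrow> real"
  assumes "x \<in> V" "U \<subseteq> {u. (u, x) \<in> E}"
  shows "(\<Sum>u\<in>U. sum g (side E u x)) = sum g (\<Union>u\<in>U. side E u x)"
proof (rule sum.UNION_disjoint[symmetric])
  show "finite U" using assms(2) finite_subset E_in_V finite_V by (metis (mono_tags) mem_Collect_eq subsetI)
  show "\<forall>u\<in>U. finite (side E u x)" using assms finite_side E_in_V by blast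
  show "\<forall>u\<in>U. \<forall>w\<in>U. u \<noteq> w \<longrightarrow> side E u x \<inter> side E w x = {}"
    using assms sides_disjoint by blast
qed

lemma Union_sides:
  assumes "x \<in> V"
  shows "(\<Union>u\<in>{u. (u, x) \<in> E}. side E u x) = V - {x}"
proof
  show "(\<Union>u\<in>{u. (u, x) \<in> E}. side E u x) \<subseteq> V - {x}"
    using side_subset E_in_V E_neq avoided_notin_side by fastforce
  show "V - {x} \<subseteq> (\<Union>u\<in>{u. (u, x) \<in> E}. side E u x)"
  proof
    fix y assume "y \<in> V - {x}"
    then obtain u where "(u, x) \<in> E" "y \<in> side E u x"
      using sides_cover[OF assms, of y] by blast
    then show "y \<in> (\<Union>u\<in>{u. (u, x) \<in> E}. side E u x)" by blast
  qed
qed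

text \<open>Seen from \<open>p\<close>, the far side of the edge is everything outside the branch of
  \<open>p\<close> at \<open>x\<close>, that is, \<open>x\<close> and the remaining
  branches.\<close>

lemma Union_other_sides:
  assumes "(p, x) \<in> E"
  shows "(\<Union>u\<in>{u. (u, x) \<in> E} - {p}. side E u x) = side E x p - {x}"
proof -
  have "side E x p = V - side E p x" using side_opposite assms by blast
  moreover have "\<forall>u\<in>{u. (u, x) \<in> E} - {p}. side E u x \<inter> side E p x = {}"
    using sides_disjoint assms by blast
  moreover have "(\<Union>u\<in>{u. (u, x) \<in> E}. side E u x)
      = side E p x \<union> (\<Union>u\<in>{u. (u, x) \<in> E} - {p}. side E u x)"
    using assms by blast
  ultimately show ?thesis using Union_sides[of x] E_in_V[OF assms] by blast
qed

end

section \<open>Centroids\<close>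

text \<open>Comparing a branch with its complement, rather than with half of the total, matches the
  sign test on \<open>balance\<close> that the program performs.\<close>

definition centroid :: "'v set \<Rightarrow> ('v \<times> 'v) set \<Rightarrow> ('v \<Rightarrow> real) \<Rightarrow> 'v \<Rightarrow> bool" where
  "centroid V E w t \<longleftrightarrow> t \<in> V \<and>
     (\<forall>u. (u, t) \<in> E \<longrightarrow> sum w (side E u t) \<le> sum w (V - side E u t))"

text \<open>The flow that sends all supply \<open>w\<close> along tree paths to \<open>t\<close>: an
  arc pointing towards \<open>t\<close> carries what lies behind it. If \<open>t\<close> is on the
  tail side, the arc points away from \<open>t\<close>.\<close>

definition tree_routing :: "('v \<times> 'v) set \<Rightarrow> ('v \<Rightarrow> real) \<Rightarrow> 'v \<Rightarrow> 'v \<times> 'v \<Rightarrow> real" where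
  "tree_routing E w t a =
     (if t \<in> side E (fst a) (snd a) then 0 else sum w (side E (fst a) (snd a)))"

context symmetric_tree
begin

text \<open>Extends the defining inequality from the arcs into \<open>t\<close> to all arcs pointing
  towards \<open>t\<close>: the tail side of such an arc lies inside one branch at \<open>t\<close>,
  and weights are nonnegative.\<close>

lemma centroid_halves:
  assumes w: "\<And>x. x \<in> V \<Longrightarrow> 0 \<le> w x"
    and t: "centroid V E w t" and xy: "(x, y) \<in> E" and "t \<notin> side E x y"
  shows "sum w (side E x y) \<le> sum w (V - side E x y)"
proof (cases "y = t")
  case True
  then show ?thesis using t xy by (simp add: centroid_def)
next
  case False
  have V: "x \<in> V" "y \<in> V" "t \<in> V" using xy t E_in_V by (auto simp: centroid_def)
  obtain q where q: "(q, t) \<in> E" "y \<in> side E q t"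
    using sides_cover[OF V(3,2)] False by blast
  have "x \<noteq> t" using assms(4) side_self by metis
  then have x: "x \<in> side E q t" using q xy E_commute side_step by metis
  \<comment> \<open>A walk inside \<open>side E x y\<close> never enters \<open>t\<close>, so from
    \<open>x\<close> it cannot leave the branch of \<open>q\<close>.\<close>
  have sub: "side E x y \<subseteq> side E q t"
  proof
    fix z assume "z \<in> side E x y"
    then show "z \<in> side E q t"
    proof (induction rule: side_induct)
      case self
      show ?case by (rule x)
    next
      case (step z z')
      then have "z' \<noteq> t" using assms(4) side_step by metis
      then show ?case using step side_step by metis
    qed
  qed
  have "q \<in> V" using q E_in_V by blast
  then have "side E q t \<subseteq> V" by (rule side_subset)
  then have "sum w (side E x y) \<le> sum w (side E q t)"
    using sub w by (intro sum_mono2) (auto intro: finite_subset[OF _ finite_V])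
  also have "\<dots> \<le> sum w (V - side E q t)" using t q by (simp add: centroid_def)
  also have "\<dots> \<le> sum w (V - side E x y)"
    using sub w finite_V by (intro sum_mono2) auto
  finally show ?thesis .
qed

text \<open>For the neighbour \<open>v\<close> the inequality is heaviness read from the other side.
  The branch of any other neighbour lies inside \<open>side E u v\<close> and misses
  \<open>u\<close>, so minimality forbids it to be heavy.\<close>

lemma smallest_heavy_side_centroid:
  assumes uv: "(u, v) \<in> E"
    and heavy: "sum w (V - side E u v) < sum w (side E u v)"
    and least: "\<And>x y. (x, y) \<in> E \<Longrightarrow> sum w (V - side E x y) < sum w (side E x y) \<Longrightarrow>
      card (side E u v) \<le> card (side E x y)"
  shows "centroid V E w u"
  unfolding centroid_def
proof (intro conjI allI impI)
  show "u \<in> V" using uv E_in_V by blast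
  fix x assume x: "(x, u) \<in> E"
  show "sum w (side E x u) \<le> sum w (V - side E x u)"
  proof (cases "x = v")
    case True
    have "side E u v \<subseteq> V" using side_subset \<open>u \<in> V\<close> by blast
    then have "V - side E v u = side E u v" using side_opposite[OF uv] by blast
    then show ?thesis using True side_opposite[OF uv] heavy by simp
  next
    case False
    have sub: "side E x u \<subseteq> side E u v"
      using Union_other_sides[OF E_commute[OF uv]] x False by blast
    moreover have "u \<notin> side E x u" using x E_neq avoided_notin_side by metis
    moreover have "u \<in> side E u v" by (rule side_self)
    ultimately have "side E x u \<subset> side E u v" by blast
    then have "card (side E x u) < card (side E u v)"
      using finite_side \<open>u \<in> V\<close> psubset_card_mono by metis
    then show ?thesis using least[OF x] by force
  qed
qed

section \<open>Tree routings and the excess across a cut\<close>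

lemma sum_in_arcs:
  "sum f {a \<in> E. snd a = x} = (\<Sum>u\<in>{u. (u, x) \<in> E}. f (u, x))"
proof -
  have "{a \<in> E. snd a = x} = (\<lambda>u. (u, x)) ` {u. (u, x) \<in> E}" by force
  then show ?thesis by (simp add: sum.reindex inj_on_def)
qed

lemma sum_out_arcs:
  "sum f {a \<in> E. fst a = x} = (\<Sum>u\<in>{u. (u, x) \<in> E}. f (x, u))"
proof -
  have "{a \<in> E. fst a = x} = (\<lambda>u. (x, u)) ` {u. (u, x) \<in> E}" using E_commute by force
  then show ?thesis by (simp add: sum.reindex inj_on_def)
qed

lemma finite_neighbours: "finite {u. (u, x) \<in> E}"
  by (rule finite_subset[OF _ finite_V]) (use E_in_V in blast)

text \<open>Away from the sink exactly one neighbour \<open>p\<close> leads to \<open>t\<close>. All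
  other branches flow in, and they leave together with \<open>w x\<close> through the arc to
  \<open>p\<close>.\<close>

lemma tree_routing_excess:
  assumes "x \<in> V" "t \<in> V"
  shows "sum (tree_routing E w t) {a \<in> E. snd a = x} - sum (tree_routing E w t) {a \<in> E. fst a = x}
    = (if x = t then sum w (V - {t}) else - w x)"
proof (cases "x = t")
  case True
  have "sum (tree_routing E w t) {a \<in> E. snd a = x} = (\<Sum>u\<in>{u. (u, x) \<in> E}. sum w (side E u x))"
    unfolding sum_in_arcs
    by (rule sum.cong) (auto simp: tree_routing_def True dest: E_neq avoided_notin_side)
  also have "\<dots> = sum w (V - {x})"
    using sum_sides[OF assms(1), of "{u. (u, x) \<in> E}" w] Union_sides[OF assms(1)] by simp
  finally have "sum (tree_routing E w t) {a \<in> E. snd a = x} = sum w (V - {x})" .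
  moreover have "sum (tree_routing E w t) {a \<in> E. fst a = x} = 0"
    unfolding sum_out_arcs by (rule sum.neutral) (auto simp: tree_routing_def True side_self)
  ultimately show ?thesis using True by simp
next
  case False
  then obtain p where p: "(p, x) \<in> E" "t \<in> side E p x"
    using sides_cover[OF assms] by metis
  have notin: "t \<notin> side E u x" if "(u, x) \<in> E" "u \<noteq> p" for u
    using sides_disjoint[OF p(1) that(1)] that(2) p(2) by blast
  have opp: "side E x u = V - side E u x" if "(u, x) \<in> E" for u
    using side_opposite[OF that] .
  have "sum (tree_routing E w t) {a \<in> E. snd a = x}
      = (\<Sum>u\<in>{u. (u, x) \<in> E} - {p}. tree_routing E w t (u, x))"
    unfolding sum_in_arcs using p finite_neighbours
    by (subst sum.remove[of _ p]) (auto simp: tree_routing_def)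
  also have "\<dots> = (\<Sum>u\<in>{u. (u, x) \<in> E} - {p}. sum w (side E u x))"
    by (rule sum.cong) (auto simp: tree_routing_def notin)
  also have "\<dots> = sum w (side E x p - {x})"
    using sum_sides[OF assms(1), of "{u. (u, x) \<in> E} - {p}" w] Union_other_sides[OF p(1)] by auto
  finally have i: "sum (tree_routing E w t) {a \<in> E. snd a = x} = sum w (side E x p - {x})" .
  have "sum (tree_routing E w t) {a \<in> E. fst a = x}
      = tree_routing E w t (x, p) + (\<Sum>u\<in>{u. (u, x) \<in> E} - {p}. tree_routing E w t (x, u))"
    unfolding sum_out_arcs using p finite_neighbours by (subst sum.remove[of _ p]) auto
  \<comment> \<open>For a neighbour \<open>u\<close> other than \<open>p\<close>, the sink is on the
    side of \<open>x\<close>, so the arc to \<open>u\<close> points away from it.\<close>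
  also have "(\<Sum>u\<in>{u. (u, x) \<in> E} - {p}. tree_routing E w t (x, u)) = 0"
    by (rule sum.neutral) (use assms in \<open>auto simp: tree_routing_def opp notin\<close>)
  finally have "sum (tree_routing E w t) {a \<in> E. fst a = x} = sum w (side E x p)"
    using p by (simp add: tree_routing_def opp)
  also have "\<dots> = w x + sum w (side E x p - {x})"
    using finite_side assms(1) side_self by (metis sum.remove)
  finally show ?thesis using i False by simp
qed

text \<open>Arcs with both ends in the side contribute once as inflow and once as outflow and
  cancel; only the two arcs of the cut edge remain.\<close>

lemma sum_excess_side:
  fixes f :: "'v \<times> 'v \<Rightarrow> real"
  assumes "(u, v) \<in> E"
  shows "(\<Sum>x\<in>side E u v. sum f {a \<in> E. snd a = x} - sum f {a \<in> E. fst a = x}) = f (v, u) - f (u, v)"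
proof -
  let ?S = "side E u v"
  have fin: "finite ?S" using finite_side assms E_in_V by blast
  have group: "(\<Sum>x\<in>?S. sum f {a \<in> E. g a = x}) = sum f {a \<in> E. g a \<in> ?S}" for g :: "'v \<times> 'v \<Rightarrow> 'v"
  proof -
    have "sum f {a \<in> E. g a \<in> ?S} = (\<Sum>x\<in>?S. sum f {a \<in> {a \<in> E. g a \<in> ?S}. g a = x})"
      by (rule sum.group[symmetric]) (use fin finite_E in auto)
    also have "\<dots> = (\<Sum>x\<in>?S. sum f {a \<in> E. g a = x})"
      by (rule sum.cong) (auto intro!: sum.cong)
    finally show ?thesis by simp
  qed
  let ?B = "{a \<in> E. fst a \<in> ?S \<and> snd a \<in> ?S}"
  have "v \<notin> ?S" "u \<in> ?S" by (simp_all add: avoided_notin_side E_neq[OF assms] side_self)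
  have cross: "fst a \<in> ?S \<and> snd a \<notin> ?S \<longleftrightarrow> a = (u, v)"
    "fst a \<notin> ?S \<and> snd a \<in> ?S \<longleftrightarrow> a = (v, u)" if "a \<in> E" for a
    using crossing_arcs[OF assms, of "fst a" "snd a"] that by simp_all
  have "{a \<in> E. snd a \<in> ?S} = insert (v, u) ?B"
    using cross(2) E_commute[OF assms] \<open>u \<in> ?S\<close> by fastforce
  moreover have "{a \<in> E. fst a \<in> ?S} = insert (u, v) ?B"
    using cross(1) assms \<open>u \<in> ?S\<close> by fastforce
  moreover have "(v, u) \<notin> ?B" "(u, v) \<notin> ?B" "finite ?B"
    using \<open>v \<notin> ?S\<close> finite_E by auto
  ultimately show ?thesis by (simp add: sum_subtractf group)
qed

end

section \<open>Flows on symmetric di-trees and the factor 2\<close>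

lemma symmetric_di_tree_tree:
  assumes "symmetric_di_tree G c"
  shows "symmetric_tree (pverts G) (parcs G)"
proof -
  have wf: "pair_wf_digraph G" and tree: "undirected_tree (pverts G) (underlying_edges G)"
    and sym: "sym (parcs G)"
    using assms by (auto simp: symmetric_di_tree_def di_tree_def)
  interpret pair_wf_digraph G by (rule wf)
  \<comment> \<open>By symmetry, forgetting the directions loses nothing: each unordered edge gives
    back both of its arcs.\<close>
  have "{(x, y). {x, y} \<in> underlying_edges G} = parcs G"
    using sym by (auto simp: underlying_edges_def doubleton_eq_iff dest: symD)
  then have conn: "\<forall>x\<in>pverts G. \<forall>y\<in>pverts G. (x, y) \<in> (parcs G)\<^sup>*"
    using tree by (simp add: undirected_tree_def)
  show ?thesis
  proof
    show "finite (pverts G)" using tree by (simp add: undirected_tree_def)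
    show "parcs G \<subseteq> pverts G \<times> pverts G" using in_arcsD1 in_arcsD2 by auto
    show "sym (parcs G)" by (rule sym)
    show "(x, x) \<notin> parcs G" for x
    proof
      assume "(x, x) \<in> parcs G"
      then have "{x, x} \<in> underlying_edges G" by (auto simp: underlying_edges_def)
      then have "card {x, x} = 2" using tree by (metis undirected_tree_def)
      then show False by simp
    qed
    show "(x, y) \<in> (parcs G)\<^sup>*" if "x \<in> pverts G" "y \<in> pverts G" for x y
      using conn that by blast
    show "\<not> undirected_cycle {{u, v} |u v. (u, v) \<in> parcs G} p" for p
      using tree by (simp add: undirected_tree_def underlying_edges_def)
  qed
qed

lemma in_arcs_with_proj: "in_arcs (with_proj G) x = {a \<in> parcs G. snd a = x}"
  and out_arcs_with_proj: "out_arcs (with_proj G) x = {a \<in> parcs G. fst a = x}"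
  by (auto simp: in_arcs_def out_arcs_def)

text \<open>Demands sum to zero over all vertices, so a set containing the sink demands exactly what
  the rest supplies.\<close>

lemma sum_route_to:
  assumes "finite (pverts G)" "S \<subseteq> pverts G" "t \<in> pverts G"
  shows "sum (route_to G s t) S = (if t \<in> S then - sum s (pverts G - S) else sum s S)"
proof (cases "t \<in> S")
  case True
  have fin: "finite S" using assms finite_subset by blast
  have "sum (route_to G s t) S = route_to G s t t + sum (route_to G s t) (S - {t})"
    using True fin by (simp add: sum.remove)
  also have "sum (route_to G s t) (S - {t}) = sum s (S - {t})"
    by (rule sum.cong) (auto simp: route_to_def)
  also have "route_to G s t t = - sum s (pverts G - {t})" by (simp add: route_to_def)
  also have "pverts G - {t} = (pverts G - S) \<union> (S - {t})" using assms True by blast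
  also have "sum s \<dots> = sum s (pverts G - S) + sum s (S - {t})"
    using assms fin by (intro sum.union_disjoint) auto
  finally show ?thesis using True by simp
next
  case False
  have "sum (route_to G s t) S = sum s S"
    by (rule sum.cong) (use False in \<open>auto simp: route_to_def\<close>)
  then show ?thesis using False by simp
qed

text \<open>Membership in the set whose supremum is \<open>flow_lambda\<close>. Since that supremum
  may be infinite, the argument concerns one scale at a time.\<close>

definition feasible_scale ::
    "'v pair_pre_digraph \<Rightarrow> ('v \<times> 'v \<Rightarrow> real) \<Rightarrow> ('v \<Rightarrow> real) list \<Rightarrow> real \<Rightarrow> bool" where
  "feasible_scale G c ds l \<longleftrightarrow> 0 \<le> l \<and>
     (\<exists>fs. length fs = length ds \<and> (\<forall>f \<in> set fs. flow G f) \<and> valid_family G c fs \<and>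
       (\<forall>i < length ds. satisfies_demand G (fs ! i) (\<lambda>v. l * (ds ! i) v)))"

lemma flow_lambda_feasible: "flow_lambda G c ds = Sup (ereal ` {l. feasible_scale G c ds l})"
  unfolding flow_lambda_def feasible_scale_def by (rule arg_cong[of _ _ Sup]) blast

text \<open>The sink is arbitrary, so it is unknown which part sends its supply across the edge and
  in which direction. The minimum and the sum of both arcs cover both cases.\<close>

lemma cut_bound:
  assumes "symmetric_tree (pverts G) (parcs G)" and uv: "(u, v) \<in> parcs G"
    and "t \<in> pverts G" and "flow G f" and "satisfies_demand G f (\<lambda>x. l * route_to G s t x)"
    and "0 \<le> l"
  defines "S \<equiv> side (parcs G) u v"
  shows "l * min (sum (\<lambda>x. - s x) S) (sum (\<lambda>x. - s x) (pverts G - S)) \<le> f (u, v) + f (v, u)"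
proof -
  interpret symmetric_tree "pverts G" "parcs G" by fact
  have S: "S \<subseteq> pverts G" unfolding S_def using side_subset E_in_V[OF uv] by blast
  have pos: "0 \<le> f (u, v)" "0 \<le> f (v, u)"
    using \<open>flow G f\<close> uv E_commute by (auto simp: flow_def)
  have "f (v, u) - f (u, v) = (\<Sum>x\<in>S. l * route_to G s t x)"
    unfolding S_def sum_excess_side[OF uv, of f, symmetric]
    by (rule sum.cong)
       (use assms(5) S S_def in \<open>auto simp: satisfies_demand_def in_arcs_with_proj out_arcs_with_proj\<close>)
  also have "\<dots> = l * sum (route_to G s t) S" by (simp add: sum_distrib_left)
  also have "\<dots> = l * (if t \<in> S then - sum s (pverts G - S) else sum s S)"
    by (simp add: sum_route_to[OF finite_V S \<open>t \<in> pverts G\<close>])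
  finally have eq: "f (v, u) - f (u, v) = l * (if t \<in> S then - sum s (pverts G - S) else sum s S)" .
  have "l * min (- sum s S) (- sum s (pverts G - S)) \<le> l * (if t \<in> S then - sum s (pverts G - S) else - sum s S)"
    using \<open>0 \<le> l\<close> by (intro mult_left_mono) auto
  also have "\<dots> \<le> f (u, v) + f (v, u)" using eq pos by (auto split: if_splits)
  finally show ?thesis by (simp add: sum_negf)
qed

text \<open>Edge by edge, the minimum over the two parts is the common term: a centroid routing
  loads an arc with at most that much, and any flow to other sinks puts at least that much on the
  two arcs together.\<close>

lemma half_scale_feasible:
  assumes tree: "symmetric_di_tree G c"
    and supp: "\<And>s. s \<in> set ss \<Longrightarrow> supply_vector G s"
    and len: "length vs = length ss" "length ts = length ss" "set ts \<subseteq> pverts G"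
    and cent: "\<And>i. i < length ss \<Longrightarrow> centroid (pverts G) (parcs G) (\<lambda>x. - (ss ! i) x) (vs ! i)"
    and feas: "feasible_scale G c (map2 (route_to G) ss ts) l"
  shows "feasible_scale G c (map2 (route_to G) ss vs) (l / 2)"
proof -
  let ?V = "pverts G" and ?E = "parcs G" and ?k = "length ss"
  let ?w = "\<lambda>i x. - (ss ! i) x"
  have T: "symmetric_tree ?V ?E" using symmetric_di_tree_tree tree by blast
  interpret symmetric_tree ?V ?E by (rule T)
  from feas obtain fs where l: "0 \<le> l" and fs: "length fs = ?k" "\<forall>f\<in>set fs. flow G f"
    "valid_family G c fs" "\<forall>i<?k. satisfies_demand G (fs ! i) (\<lambda>v. l * route_to G (ss ! i) (ts ! i) v)"
    by (auto simp: feasible_scale_def len)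
  have w: "0 \<le> ?w i x" if "i < ?k" "x \<in> ?V" for i x
    using supp[of "ss ! i"] that by (auto simp: supply_vector_def)
  \<comment> \<open>The scale is halved because a load that \<open>fs\<close> may split between both
    arcs of an edge can fall on a single one here.\<close>
  define g where "g i a = l / 2 * tree_routing ?E (?w i) (vs ! i) a" for i a
  have vs: "vs ! i \<in> ?V" if "i < ?k" for i using cent[OF that] by (simp add: centroid_def)
  have demand: "satisfies_demand G (g i) (\<lambda>x. l / 2 * route_to G (ss ! i) (vs ! i) x)" if "i < ?k" for i
    unfolding satisfies_demand_def in_arcs_with_proj out_arcs_with_proj g_def
  proof
    fix x assume "x \<in> ?V"
    from tree_routing_excess[OF this vs[OF that], of "?w i"]
    show "(\<Sum>a\<in>{a \<in> ?E. snd a = x}. l / 2 * tree_routing ?E (?w i) (vs ! i) a)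
      - (\<Sum>a\<in>{a \<in> ?E. fst a = x}. l / 2 * tree_routing ?E (?w i) (vs ! i) a)
      = l / 2 * route_to G (ss ! i) (vs ! i) x"
      unfolding sum_distrib_left[symmetric] right_diff_distrib[symmetric]
      by (simp add: route_to_def sum_negf)
  qed
  have flow: "flow G (g i)" if "i < ?k" for i
    unfolding flow_def
  proof
    fix a assume "a \<in> ?E"
    then have "side ?E (fst a) (snd a) \<subseteq> ?V"
      using side_subset E_in_V[of "fst a" "snd a"] by simp
    then have "0 \<le> sum (?w i) (side ?E (fst a) (snd a))"
      using w[OF that] by (intro sum_nonneg) blast
    then show "0 \<le> g i a" using l by (simp add: g_def tree_routing_def)
  qed
  have cap: "(\<Sum>i<?k. g i a) \<le> c a" if "a \<in> ?E" for a
  proof -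
    obtain u v where a: "a = (u, v)" by force
    let ?S = "side ?E u v"
    let ?m = "\<lambda>i. min (sum (?w i) ?S) (sum (?w i) (?V - ?S))"
    have uv: "(u, v) \<in> ?E" "(v, u) \<in> ?E" using that a E_commute by auto
    have S: "?S \<subseteq> ?V" using side_subset E_in_V uv by blast
    have "tree_routing ?E (?w i) (vs ! i) a \<le> ?m i" if "i < ?k" for i
    proof (cases "vs ! i \<in> ?S")
      case True
      have "0 \<le> sum (?w i) ?S" "0 \<le> sum (?w i) (?V - ?S)"
        using w[OF that] S by (auto intro!: sum_nonneg)
      then show ?thesis using True by (simp add: tree_routing_def a)
    next
      case False
      then show ?thesis using centroid_halves[OF w[OF that] cent[OF that] uv(1)]
        by (simp add: tree_routing_def a)
    qed
    then have "(\<Sum>i<?k. g i a) \<le> (\<Sum>i<?k. l / 2 * ?m i)"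
      unfolding g_def using l by (intro sum_mono mult_left_mono) auto
    also have "\<dots> = (\<Sum>i<?k. l * ?m i) / 2" by (simp add: sum_divide_distrib)
    also have "(\<Sum>i<?k. l * ?m i) \<le> (\<Sum>i<?k. (fs ! i) (u, v) + (fs ! i) (v, u))"
      using fs len l by (intro sum_mono cut_bound[OF T uv(1)]) (auto simp: subset_iff)
    also have "\<dots> = (\<Sum>f\<leftarrow>fs. f (u, v)) + (\<Sum>f\<leftarrow>fs. f (v, u))"
      by (simp add: sum.distrib sum_list_sum_nth fs atLeast0LessThan)
    also have "\<dots> \<le> c (u, v) + c (v, u)"
      using fs(3) uv by (auto simp: valid_family_def intro: add_mono)
    \<comment> \<open>Equal capacities make the right-hand side twice \<open>c a\<close>, which
      cancels the halving.\<close>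
    also have "c (v, u) = c (u, v)" using tree uv unfolding symmetric_di_tree_def by blast
    finally show ?thesis using a by simp
  qed
  show ?thesis
    unfolding feasible_scale_def
  proof (intro conjI exI[of _ "map g [0..<?k]"])
    show "valid_family G c (map g [0..<?k])"
      using cap by (simp add: valid_family_def comp_def interv_sum_list_conv_sum_set_nat atLeast0LessThan)
    show "\<forall>i<length (map2 (route_to G) ss vs).
       satisfies_demand G (map g [0..<?k] ! i) (\<lambda>v. l / 2 * (map2 (route_to G) ss vs ! i) v)"
      using demand len by simp
  qed (use flow len l in auto)
qed

text \<open>The factor is first moved to the right as 2, where it can be compared with each feasible
  \<open>l\<close>; halving at the end is harmless in the extended reals, also at infinity.\<close>

theorem centroids_half_optimal:
  assumes "symmetric_di_tree G c"
    and "\<And>s. s \<in> set ss \<Longrightarrow> supply_vector G s"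
    and "length vs = length ss"
    and "\<And>i. i < length ss \<Longrightarrow> centroid (pverts G) (parcs G) (\<lambda>x. - (ss ! i) x) (vs ! i)"
  shows "1 / 2 * lomuf_opt G c ss \<le> lomuf_value G c ss vs"
proof -
  have "lomuf_opt G c ss \<le> 2 * lomuf_value G c ss vs"
    unfolding lomuf_opt_def
  proof (rule SUP_least)
    fix ts assume "ts \<in> {ts. length ts = length ss \<and> set ts \<subseteq> pverts G}"
    then have ts: "length ts = length ss" "set ts \<subseteq> pverts G" by auto
    show "lomuf_value G c ss ts \<le> 2 * lomuf_value G c ss vs"
      unfolding lomuf_value_def flow_lambda_feasible[of G c "map2 (route_to G) ss ts"]
    proof (rule SUP_least)
      fix l assume "l \<in> {l. feasible_scale G c (map2 (route_to G) ss ts) l}"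
      then have "feasible_scale G c (map2 (route_to G) ss vs) (l / 2)"
        using half_scale_feasible[OF assms(1-3) ts assms(4)] by blast
      then have "ereal (l / 2) \<le> flow_lambda G c (map2 (route_to G) ss vs)"
        unfolding flow_lambda_feasible by (intro SUP_upper) simp
      then have "2 * ereal (l / 2) \<le> 2 * flow_lambda G c (map2 (route_to G) ss vs)"
        by (intro ereal_mult_left_mono) auto
      moreover have "2 * ereal (l / 2) = ereal l"
        using times_ereal.simps(1)[of 2 "l / 2"] by simp
      ultimately show "ereal l \<le> 2 * flow_lambda G c (map2 (route_to G) ss vs)" by simp
    qed
  qed
  then have "1 / 2 * lomuf_opt G c ss \<le> 1 / 2 * (2 * lomuf_value G c ss vs)"
    by (intro ereal_mult_left_mono) auto
  also have "\<dots> = lomuf_value G c ss vs"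
  proof -
    have "1 / 2 * (2::ereal) = 1"
      by (simp add: divide_ereal_def one_ereal_def)
    then show ?thesis by (simp add: mult.assoc[symmetric])
  qed
  finally show ?thesis .
qed

section \<open>Cost-bounded program correctness\<close>

lemma int_size_le_iff: "int_size z \<le> Suc k \<longleftrightarrow> \<bar>z\<bar> < 2 ^ k"
proof -
  have "floorlog 2 (nat \<bar>z\<bar>) \<le> k \<longleftrightarrow> nat \<bar>z\<bar> < 2 ^ k"
    using floorlog_leD floorlog_leI by (metis le0 one_less_numeral_iff semiring_norm(76))
  also have "\<dots> \<longleftrightarrow> \<bar>z\<bar> < 2 ^ k"
    by (metis abs_ge_zero nat_less_iff of_nat_numeral of_nat_power)
  finally show ?thesis by (simp add: int_size_def)
qed

lemma int_size_pos: "1 \<le> int_size z"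
  by (simp add: int_size_def)

lemma abs_less_power_int_size: "\<bar>z\<bar> < 2 ^ (int_size z - 1)"
  using int_size_le_iff[of z "int_size z - 1"] int_size_pos[of z] by simp

lemma int_size_mono: "\<bar>y\<bar> \<le> \<bar>z\<bar> \<Longrightarrow> int_size y \<le> int_size z"
  using int_size_le_iff[of y "int_size z - 1"] abs_less_power_int_size[of z] int_size_pos[of z] by simp

text \<open>Both sizes include a unit for the sign; the second of these pays for the carry.\<close>

lemma int_size_add: "int_size (y + z) \<le> int_size y + int_size z"
proof -
  obtain a b where ab: "int_size y = Suc a" "int_size z = Suc b"
    using int_size_pos by (metis Suc_le_D One_nat_def)
  then have "\<bar>y\<bar> < 2 ^ a" "\<bar>z\<bar> < 2 ^ b" by (metis int_size_le_iff order_refl)+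
  moreover have "(2::int) ^ a \<le> 2 ^ (a + b)" "(2::int) ^ b \<le> 2 ^ (a + b)"
    by (rule power_increasing; simp)+
  moreover have "\<bar>y + z\<bar> \<le> \<bar>y\<bar> + \<bar>z\<bar>" by (rule abs_triangle_ineq)
  ultimately have "\<bar>y + z\<bar> < 2 * 2 ^ (a + b)" by linarith
  then have "\<bar>y + z\<bar> < 2 ^ Suc (a + b)" by simp
  then have "int_size (y + z) \<le> Suc (Suc (a + b))" unfolding int_size_le_iff .
  then show ?thesis using ab by simp
qed

lemma int_size_minus: "int_size (- z) = int_size z"
  by (simp add: int_size_def)

lemma int_size_diff: "int_size (y - z) \<le> int_size y + int_size z"
  using int_size_add[of y "- z"] by (simp add: int_size_minus)

lemma int_size_mult: "int_size (y * z) \<le> int_size y + int_size z"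
proof -
  obtain a b where ab: "int_size y = Suc a" "int_size z = Suc b"
    using int_size_pos by (metis Suc_le_D One_nat_def)
  then have "\<bar>y\<bar> < 2 ^ a" "\<bar>z\<bar> < 2 ^ b" by (metis int_size_le_iff order_refl)+
  then have "\<bar>y * z\<bar> < 2 ^ (a + b)"
    by (simp add: abs_mult power_add mult_strict_mono')
  then have "int_size (y * z) \<le> Suc (a + b)" unfolding int_size_le_iff .
  then show ?thesis using ab by simp
qed

text \<open>Measures values in words of length \<open>int_size H\<close>. A \<open>Load\<close>
  counts as one word whatever its address, since every cell is bounded; sums and products at most
  add lengths.\<close>

fun size_factor :: "exp \<Rightarrow> nat" where
  "size_factor (Const z) = int_size z"
| "size_factor (Load e) = 1"
| "size_factor (Add e1 e2) = size_factor e1 + size_factor e2"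
| "size_factor (Sub e1 e2) = size_factor e1 + size_factor e2"
| "size_factor (Mul e1 e2) = size_factor e1 + size_factor e2"

fun cost_factor :: "exp \<Rightarrow> nat" where
  "cost_factor (Const z) = int_size z"
| "cost_factor (Load e) = cost_factor e + 1"
| "cost_factor (Add e1 e2) = cost_factor e1 + cost_factor e2 + size_factor e1 + size_factor e2"
| "cost_factor (Sub e1 e2) = cost_factor e1 + cost_factor e2 + size_factor e1 + size_factor e2"
| "cost_factor (Mul e1 e2) = cost_factor e1 + cost_factor e2 + size_factor e1 + size_factor e2"

text \<open>All addresses are included, so a \<open>Load\<close> can be bounded without knowing
  which cell it reads.\<close>

definition bounded_memory :: "int \<Rightarrow> memory \<Rightarrow> bool" where
  "bounded_memory H m \<longleftrightarrow> (\<forall>x. \<bar>m x\<bar> \<le> H)"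

lemma bounded_memory_int_size: "bounded_memory H m \<Longrightarrow> int_size (m x) \<le> int_size H"
  unfolding bounded_memory_def by (rule int_size_mono) (meson abs_ge_self order_trans)

lemma le_mult_int_size: "k \<le> k * int_size z"
  using int_size_pos[of z] by simp

lemma int_size_val:
  assumes "bounded_memory H m"
  shows "int_size (val e m) \<le> size_factor e * int_size H"
proof (induction e)
  case (Const z)
  show ?case by (simp add: le_mult_int_size)
next
  case (Load e)
  show ?case using bounded_memory_int_size[OF assms] by simp
next
  case (Add e1 e2)
  then show ?case using int_size_add[of "val e1 m" "val e2 m"] by (simp add: distrib_right)
next
  case (Sub e1 e2)
  then show ?case using int_size_diff[of "val e1 m" "val e2 m"] by (simp add: distrib_right)
next
  case (Mul e1 e2)
  then show ?case using int_size_mult[of "val e1 m" "val e2 m"] by (simp add: distrib_right)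
qed

lemma val_cost_le:
  assumes "bounded_memory H m"
  shows "val_cost e m \<le> cost_factor e * int_size H"
proof (induction e)
  case (Const z)
  show ?case by (simp add: le_mult_int_size)
next
  case (Load e)
  then show ?case using bounded_memory_int_size[OF assms, of "val e m"] by simp
next
  case (Add e1 e2)
  then show ?case using int_size_val[OF assms, of "Add e1 e2"] by (simp add: distrib_right)
next
  case (Sub e1 e2)
  then show ?case using int_size_val[OF assms, of "Sub e1 e2"] by (simp add: distrib_right)
next
  case (Mul e1 e2)
  then show ?case using int_size_val[OF assms, of "Mul e1 e2"] by (simp add: distrib_right)
qed

text \<open>Bounds the cost, in units of the word length, of a program all of whose loops are iterated
  at most \<open>s\<close> times per entry.\<close>

fun steps :: "nat \<Rightarrow> prog \<Rightarrow> nat" where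
  "steps s Skip = 1"
| "steps s (Store a e) = 1 + cost_factor a + cost_factor e"
| "steps s (Seq p q) = steps s p + steps s q"
| "steps s (IfPos e p q) = 1 + cost_factor e + steps s p + steps s q"
| "steps s (WhilePos e p) = 1 + cost_factor e + s * (1 + cost_factor e + steps s p)"

text \<open>Each loop contributes one factor \<open>s\<close>, and the nesting of loops is fixed by
  the program.\<close>

lemma steps_poly: "\<exists>B. \<forall>s. steps s p = poly B s"
proof (induction p)
  case Skip
  show ?case by (rule exI[of _ 1]) simp
next
  case (Store a e)
  show ?case by (rule exI[of _ "[:1 + cost_factor a + cost_factor e:]"]) simp
next
  case (Seq p q)
  then obtain B C where "\<forall>s. steps s p = poly B s" "\<forall>s. steps s q = poly C s" by blast
  then show ?case by (intro exI[of _ "B + C"]) simp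
next
  case (IfPos e p q)
  then obtain B C where "\<forall>s. steps s p = poly B s" "\<forall>s. steps s q = poly C s" by blast
  then show ?case by (intro exI[of _ "[:1 + cost_factor e:] + B + C"]) simp
next
  case (WhilePos e p)
  then obtain B where "\<forall>s. steps s p = poly B s" by blast
  then show ?case
    by (intro exI[of _ "[:1 + cost_factor e:] + [:0, 1:] * ([:1 + cost_factor e:] + B)"]) simp
qed

text \<open>Termination, cost, boundedness and postcondition in one predicate, so that loop
  invariants need not mention time. The cost bound depends on the program text, \<open>s\<close> and
  \<open>H\<close> only.\<close>

definition wp :: "int \<Rightarrow> nat \<Rightarrow> prog \<Rightarrow> memory \<Rightarrow> (memory \<Rightarrow> bool) \<Rightarrow> bool" where
  "wp H s p m Q \<longleftrightarrow>
     (\<exists>t m'. exec p m t m' \<and> t \<le> steps s p * int_size H \<and> bounded_memory H m' \<and> Q m')"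

lemma wp_Skip: "bounded_memory H m \<Longrightarrow> Q m \<Longrightarrow> wp H s Skip m Q"
  unfolding wp_def using exec.Skip le_mult_int_size[of 1 H] by fastforce

lemma wp_Store:
  assumes "bounded_memory H m" "\<bar>val e m\<bar> \<le> H" "Q (m(val a m := val e m))"
  shows "wp H s (Store a e) m Q"
  unfolding wp_def
proof (intro exI conjI)
  show "exec (Store a e) m (1 + val_cost a m + val_cost e m) (m(val a m := val e m))"
    by (rule exec.Store)
  show "1 + val_cost a m + val_cost e m \<le> steps s (Store a e) * int_size H"
    using val_cost_le[OF assms(1), of a] val_cost_le[OF assms(1), of e] int_size_pos[of H]
    by (simp add: distrib_right)
qed (use assms in \<open>auto simp: bounded_memory_def\<close>)

lemma wp_Seq:
  assumes "wp H s p m (\<lambda>m'. wp H s q m' Q)"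
  shows "wp H s (Seq p q) m Q"
proof -
  obtain t m' t' m'' where "exec p m t m'" "t \<le> steps s p * int_size H"
    "exec q m' t' m''" "t' \<le> steps s q * int_size H" "bounded_memory H m''" "Q m''"
    using assms unfolding wp_def by blast
  then show ?thesis
    unfolding wp_def by (intro exI[of _ "t + t'"] exI[of _ m'']) (auto simp: distrib_right intro: exec.Seq)
qed

lemma wp_Store_val:
  assumes "bounded_memory H m" "val a m = x" "val e m = z" "\<bar>z\<bar> \<le> H" "Q (m(x := z))"
  shows "wp H s (Store a e) m Q"
  using wp_Store[of H m e Q a s] assms by simp

text \<open>Symbolic execution with the address \<open>x\<close> and the value \<open>z\<close>
  already simplified, so that expressions do not pile up in the memory term.\<close>

lemma wp_Store_Seq:
  assumes "bounded_memory H m" "val a m = x" "val e m = z" "\<bar>z\<bar> \<le> H"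
    and "bounded_memory H (m(x := z)) \<Longrightarrow> wp H s p (m(x := z)) Q"
  shows "wp H s (Seq (Store a e) p) m Q"
  by (rule wp_Seq, rule wp_Store_val[OF assms(1-4)], rule assms(5))
     (use assms(1,4) in \<open>auto simp: bounded_memory_def\<close>)

lemma wp_IfPos:
  assumes "bounded_memory H m"
    and "val e m > 0 \<Longrightarrow> wp H s p m Q" and "val e m \<le> 0 \<Longrightarrow> wp H s q m Q"
  shows "wp H s (IfPos e p q) m Q"
proof (cases "val e m > 0")
  case True
  with assms(2) obtain t m' where "exec p m t m'" "t \<le> steps s p * int_size H"
    "bounded_memory H m'" "Q m'"
    unfolding wp_def by blast
  moreover from this have "exec (IfPos e p q) m (1 + val_cost e m + t) m'"
    using True by (intro exec.IfPos_true) auto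
  moreover have "1 + val_cost e m + t \<le> steps s (IfPos e p q) * int_size H"
    using calculation val_cost_le[OF assms(1), of e] int_size_pos[of H]
    by (simp add: distrib_right)
  ultimately show ?thesis unfolding wp_def by blast
next
  case False
  with assms(3) obtain t m' where "exec q m t m'" "t \<le> steps s q * int_size H"
    "bounded_memory H m'" "Q m'"
    unfolding wp_def by (meson not_le)
  moreover from this have "exec (IfPos e p q) m (1 + val_cost e m + t) m'"
    using False by (intro exec.IfPos_false) auto
  moreover have "1 + val_cost e m + t \<le> steps s (IfPos e p q) * int_size H"
    using calculation val_cost_le[OF assms(1), of e] int_size_pos[of H]
    by (simp add: distrib_right)
  ultimately show ?thesis unfolding wp_def by blast
qed

lemma wp_mono:
  assumes "wp H s p m Q" "\<And>m'. bounded_memory H m' \<Longrightarrow> Q m' \<Longrightarrow> Q' m'"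
  shows "wp H s p m Q'"
  using assms unfolding wp_def by blast

text \<open>The invariant is indexed by the number of completed iterations, and their total
  \<open>n\<close> is known in advance; the induction is on the number of those left.\<close>

lemma wp_While:
  assumes "bounded_memory H m" "Inv 0 m" "n \<le> s"
    and step: "\<And>j m. j < n \<Longrightarrow> bounded_memory H m \<Longrightarrow> Inv j m \<Longrightarrow>
      val e m > 0 \<and> wp H s p m (Inv (Suc j))"
    and exit: "\<And>m. bounded_memory H m \<Longrightarrow> Inv n m \<Longrightarrow> val e m \<le> 0 \<and> Q m"
  shows "wp H s (WhilePos e p) m Q"
proof -
  have "\<exists>t m'. exec (WhilePos e p) m t m' \<and>
      t \<le> (1 + cost_factor e + (n - j) * (1 + cost_factor e + steps s p)) * int_size H \<and>
      bounded_memory H m' \<and> Q m'" if "j \<le> n" "bounded_memory H m" "Inv j m" for j m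
    using that
  proof (induction "n - j" arbitrary: j m)
    case 0
    then have "val e m \<le> 0" "Q m" using exit by auto
    then show ?case
      using 0 exec.WhilePos_false val_cost_le[of H m e] int_size_pos[of H]
      by (intro exI[of _ "1 + val_cost e m"] exI[of _ m]) (auto simp: distrib_right)
  next
    case (Suc d)
    let ?h = "int_size H"
    from Suc have j: "j < n" by simp
    with Suc step obtain t m' where t: "val e m > 0" "exec p m t m'" "t \<le> steps s p * ?h"
      "bounded_memory H m'" "Inv (Suc j) m'"
      unfolding wp_def by meson
    obtain t' m'' where t': "exec (WhilePos e p) m' t' m''"
      "t' \<le> (1 + cost_factor e + (n - Suc j) * (1 + cost_factor e + steps s p)) * ?h"
      "bounded_memory H m''" "Q m''"
    proof -
      have "d = n - Suc j" "Suc j \<le> n" using Suc.hyps(2) j by auto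
      from Suc.hyps(1)[OF this t(4,5)] that show thesis by blast
    qed
    \<comment> \<open>With this name \<open>n - j\<close> becomes \<open>Suc r\<close>, and the cost
      of one iteration splits off the product.\<close>
    define r where "r = n - Suc j"
    have "n - j = Suc r" using j by (simp add: r_def)
    then have "1 + val_cost e m + t + t'
        \<le> (1 + cost_factor e + (n - j) * (1 + cost_factor e + steps s p)) * ?h"
      using t(3) t'(2)[folded r_def] val_cost_le[OF Suc.prems(2), of e] int_size_pos[of H]
      by (simp add: distrib_right)
    then show ?case using exec.WhilePos_true[OF t(1,2) t'(1)] t' by blast
  qed
  from this[of 0 m] assms(1,2) obtain t m' where "exec (WhilePos e p) m t m'"
    "t \<le> (1 + cost_factor e + n * (1 + cost_factor e + steps s p)) * int_size H"
    "bounded_memory H m'" "Q m'"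
    by auto
  moreover have "(1 + cost_factor e + n * (1 + cost_factor e + steps s p)) * int_size H
      \<le> steps s (WhilePos e p) * int_size H"
    using \<open>n \<le> s\<close> by (simp add: mult_le_mono1 add_mono)
  ultimately show ?thesis unfolding wp_def by (meson order_trans)
qed

abbreviation var :: "int \<Rightarrow> exp" where
  "var x \<equiv> Load (Const x)"

definition For :: "int \<Rightarrow> exp \<Rightarrow> prog \<Rightarrow> prog" where
  "For x e p = Seq (Store (Const x) (Const 0))
     (WhilePos (Sub e (var x)) (Seq p (Store (Const x) (Add (var x) (Const 1)))))"

text \<open>The limit \<open>e\<close> is evaluated anew before each iteration, so its value has to
  follow from the invariant. The invariant for \<open>Suc j\<close> is required of the memory after
  the counter is increased.\<close>

lemma wp_For:
  assumes "bounded_memory H m" and "n \<le> s" and "int n \<le> H"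
    and init: "Inv 0 (m(x := 0))"
    and limit: "\<And>j m. Inv j m \<Longrightarrow> j \<le> n \<Longrightarrow> m x = int j \<Longrightarrow> val e m = int n"
    and step: "\<And>j m. j < n \<Longrightarrow> bounded_memory H m \<Longrightarrow> m x = int j \<Longrightarrow> Inv j m \<Longrightarrow>
      wp H s p m (\<lambda>m'. m' x = int j \<and> Inv (Suc j) (m'(x := int (Suc j))))"
    and exit: "\<And>m. bounded_memory H m \<Longrightarrow> m x = int n \<Longrightarrow> Inv n m \<Longrightarrow> Q m"
  shows "wp H s (For x e p) m Q"
  unfolding For_def
proof (rule wp_Seq, rule wp_Store)
  let ?Inv = "\<lambda>j m. m x = int j \<and> Inv j m"
  have "bounded_memory H (m(x := 0))" using assms(1,3) by (auto simp: bounded_memory_def)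
  then show "wp H s (WhilePos (Sub e (var x)) (Seq p (Store (Const x) (Add (var x) (Const 1)))))
     (m(val (Const x) m := val (Const 0) m)) Q"
    unfolding val.simps
  proof (rule wp_While[where Inv = ?Inv and n = n])
    fix j m assume j: "j < n" and m: "bounded_memory H m" and inv: "m x = int j \<and> Inv j m"
    have "wp H s p m (\<lambda>m'. wp H s (Store (Const x) (Add (var x) (Const 1))) m' (?Inv (Suc j)))"
    proof (rule wp_mono[OF step[OF j m]])
      fix m' assume "bounded_memory H m'" and m': "m' x = int j \<and> Inv (Suc j) (m'(x := int (Suc j)))"
      moreover have "val (Add (var x) (Const 1)) m' = int (Suc j)" using m' by simp
      ultimately show "wp H s (Store (Const x) (Add (var x) (Const 1))) m' (?Inv (Suc j))"
        using j assms(3) by (intro wp_Store) (simp_all add: add.commute)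
    qed (use inv in simp_all)
    then show "0 < val (Sub e (var x)) m \<and>
        wp H s (Seq p (Store (Const x) (Add (var x) (Const 1)))) m (?Inv (Suc j))"
      using limit[of j m] inv j wp_Seq by auto
  qed (use init limit exit assms(2) in auto)
qed (use assms in auto)

section \<open>The program\<close>

text \<open>Loop counters: \<open>-1\<close> for commodities, \<open>-2\<close> for arcs, \<open>-3\<close> for rounds of marking, \<open>-4\<close> for the
  arcs in such a round, \<open>-5\<close> for vertices. The fraction \<open>-6\<close> over \<open>-7\<close> accumulates the supply of
  the marked vertices minus that of the unmarked ones, and \<open>-8\<close> counts the marked vertices. Cells
  \<open>-9\<close> and \<open>-10\<close> hold the tail and the size of the smallest heavy side found so far, and \<open>-11\<close>
  saves the number of commodities while the output overwrites the input. Below them, the results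
  of the commodities (even cells) and the marks of the vertices (odd cells) alternate.\<close>

definition mark_cell :: "nat \<Rightarrow> int" where
  "mark_cell x = - 21 - 2 * int x"

definition result_cell :: "nat \<Rightarrow> int" where
  "result_cell i = - 20 - 2 * int i"

abbreviation mark_exp :: "exp \<Rightarrow> exp" where
  "mark_exp e \<equiv> Sub (Const (- 21)) (Mul (Const 2) e)"

abbreviation result_exp :: "exp \<Rightarrow> exp" where
  "result_exp e \<equiv> Sub (Const (- 20)) (Mul (Const 2) e)"

text \<open>Cells 1 to 3 hold the header; from cell 4 on every arc takes four cells: tail, head, and
  the numerator and denominator of its capacity.\<close>

abbreviation tail_exp :: "int \<Rightarrow> exp" where
  "tail_exp a \<equiv> Load (Add (Const 4) (Mul (Const 4) (var a)))"

abbreviation head_exp :: "int \<Rightarrow> exp" where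
  "head_exp a \<equiv> Load (Add (Const 5) (Mul (Const 4) (var a)))"

text \<open>The supplies follow the arcs, row by row, two cells per vertex. The offset
  \<open>c\<close> is 4 for the numerator and 5 for the denominator.\<close>

abbreviation supply_exp :: "int \<Rightarrow> exp" where
  "supply_exp c \<equiv> Load (Add (Add (Const c) (Mul (Const 4) (var 2)))
     (Mul (Const 2) (Add (Mul (var (- 1)) (var 1)) (var (- 5)))))"

definition clear_marks :: prog where
  "clear_marks = For (- 5) (var 1) (Store (mark_exp (var (- 5))) (Const 0))"

text \<open>The test is positive iff the tail of the arc is marked and its head is not the head of the arc
  in cell \<open>-2\<close>, the vertex that the marking has to avoid.\<close>

definition propagate_marks :: prog where
  "propagate_marks = For (- 4) (var 2)
     (IfPos (Mul (Load (mark_exp (tail_exp (- 4))))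
         (Mul (Sub (head_exp (- 4)) (head_exp (- 2))) (Sub (head_exp (- 4)) (head_exp (- 2)))))
       (Store (mark_exp (head_exp (- 4))) (Const 1)) Skip)"

text \<open>Every round advances the marking by at least one step along arcs, so as many rounds as
  there are arcs reach the whole side.\<close>

definition mark_side :: prog where
  "mark_side = Seq (Store (mark_exp (tail_exp (- 2))) (Const 1)) (For (- 3) (var 2) propagate_marks)"

text \<open>A mark is 0 or 1, so twice the mark minus 1 is the sign of the summand. Cell
  \<open>-6\<close> is updated before \<open>-7\<close> because it needs the old
  denominator.\<close>

definition compare_supplies :: prog where
  "compare_supplies = Seq (Store (Const (- 6)) (Const 0)) (Seq (Store (Const (- 7)) (Const 1))
     (Seq (Store (Const (- 8)) (Const 0)) (For (- 5) (var 1)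
       (Seq (Store (Const (- 6)) (Add (Mul (var (- 6)) (supply_exp 5))
           (Mul (Sub (Mul (Const 2) (Load (mark_exp (var (- 5))))) (Const 1))
             (Mul (var (- 7)) (supply_exp 4)))))
       (Seq (Store (Const (- 7)) (Mul (var (- 7)) (supply_exp 5)))
         (Store (Const (- 8)) (Add (var (- 8)) (Load (mark_exp (var (- 5)))))))))))"

text \<open>Supplies are at most 0, so a heavy marked side shows as a negative accumulated
  fraction.\<close>

definition update_best :: prog where
  "update_best = IfPos (Sub (Const 0) (var (- 6)))
     (IfPos (Sub (var (- 10)) (var (- 8)))
       (Seq (Store (Const (- 9)) (tail_exp (- 2))) (Store (Const (- 10)) (var (- 8)))) Skip) Skip"

text \<open>The default is vertex 0 with size \<open>n\<close>. A side of a tree arc misses the head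
  and has fewer than \<open>n\<close> vertices, so the first heavy side replaces the
  default.\<close>

definition find_centroid :: prog where
  "find_centroid = Seq (Store (Const (- 9)) (Const 0)) (Seq (Store (Const (- 10)) (var 1))
     (For (- 2) (var 2) (Seq clear_marks (Seq mark_side (Seq compare_supplies update_best)))))"

definition lomuf_program :: prog where
  "lomuf_program = Seq (For (- 1) (var 3)
       (Seq find_centroid (Store (result_exp (var (- 1))) (var (- 9)))))
     (Seq (Store (Const (- 11)) (var 3))
     (Seq (For (- 1) (var (- 11))
       (Store (Add (Const 1) (var (- 1))) (Load (result_exp (var (- 1))))))
     (Store (Const 0) (var (- 11)))))"

section \<open>Separation of memory cells, and framing\<close>

lemma mark_cell_eq_iff [simp]: "mark_cell x = mark_cell y \<longleftrightarrow> x = y"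
  by (simp add: mark_cell_def)

lemma mark_cell_neq_register [simp]: "- 20 \<le> c \<Longrightarrow> mark_cell x \<noteq> c" "- 20 \<le> c \<Longrightarrow> c \<noteq> mark_cell x"
  by (auto simp: mark_cell_def)

lemma register_notin_marks [simp]: "- 20 \<le> c \<Longrightarrow> c \<notin> range mark_cell"
  by (auto simp: mark_cell_def)

lemma result_cell_eq_iff [simp]: "result_cell x = result_cell y \<longleftrightarrow> x = y"
  by (simp add: result_cell_def)

lemma result_cell_neq_register [simp]:
  "- 19 \<le> c \<Longrightarrow> result_cell x \<noteq> c" "- 19 \<le> c \<Longrightarrow> c \<noteq> result_cell x"
  by (auto simp: result_cell_def)

lemma result_cell_notin_marks [simp]: "result_cell i \<notin> range mark_cell"
  by (auto simp: mark_cell_def result_cell_def) presburger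

definition frame :: "int set \<Rightarrow> memory \<Rightarrow> memory \<Rightarrow> bool" where
  "frame W m m' \<longleftrightarrow> (\<forall>x. x \<notin> W \<longrightarrow> m' x = m x)"

lemma frame_upd: "frame W m m' \<Longrightarrow> x \<in> W \<Longrightarrow> frame W m (m'(x := z))"
  by (auto simp: frame_def)

lemma frame_trans: "frame W m m' \<Longrightarrow> frame U m' m'' \<Longrightarrow> U \<subseteq> W \<Longrightarrow> frame W m m''"
  by (force simp: frame_def)

lemma frame_outside: "frame W m m' \<Longrightarrow> x \<notin> W \<Longrightarrow> m' x = m x"
  by (simp add: frame_def)

text \<open>What the program proof needs to know of an instance. The bound \<open>n \<le> s\<close>
  will come from the supply blocks and is asked for only if there is a commodity; all loops over
  vertices run inside one. The product bounds the accumulated fraction.\<close>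

locale encoded_network =
  fixes H :: int and s n :: nat and es :: "(nat \<times> nat) list" and k :: nat
    and num den :: "nat \<Rightarrow> nat \<Rightarrow> int"
  assumes size_bounds: "int s \<le> H" "int n \<le> H" "length es \<le> s" "k \<le> s" "0 < k \<Longrightarrow> n \<le> s" "0 < s"
    and arcs: "(x, y) \<in> set es \<Longrightarrow> x < n \<and> y < n"
    and den_pos: "i < k \<Longrightarrow> x < n \<Longrightarrow> 0 < den i x"
    and prod_bound: "i < k \<Longrightarrow> j \<le> n \<Longrightarrow> (\<Prod>x<j. \<bar>num i x\<bar> + den i x) \<le> H"
begin

definition input_ok :: "memory \<Rightarrow> bool" where
  "input_ok m \<longleftrightarrow> m 1 = int n \<and> m 2 = int (length es) \<and> m 3 = int k \<and>
     (\<forall>j < length es. m (4 + 4 * int j) = int (fst (es ! j)) \<and> m (5 + 4 * int j) = int (snd (es ! j))) \<and>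
     (\<forall>i < k. \<forall>x < n. m (4 + 4 * int (length es) + 2 * (int i * int n + int x)) = num i x \<and>
       m (5 + 4 * int (length es) + 2 * (int i * int n + int x)) = den i x)"

lemma input_ok_frame: "input_ok m \<Longrightarrow> frame W m m' \<Longrightarrow> (\<And>x. x \<in> W \<Longrightarrow> x < 0) \<Longrightarrow> input_ok m'"
proof -
  assume "input_ok m" "frame W m m'" "\<And>x. x \<in> W \<Longrightarrow> x < 0"
  then have "m' x = m x" if "0 \<le> x" for x
    using that by (force simp: frame_def)
  then show ?thesis using \<open>input_ok m\<close> by (simp add: input_ok_def)
qed

lemma input_okD:
  assumes "input_ok m"
  shows "m 1 = int n" "m 2 = int (length es)" "m 3 = int k"
    and "j < length es \<Longrightarrow> m (4 + 4 * int j) = int (fst (es ! j))"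
    and "j < length es \<Longrightarrow> m (5 + 4 * int j) = int (snd (es ! j))"
    and "i < k \<Longrightarrow> x < n \<Longrightarrow> m (4 + 4 * int (length es) + 2 * (int i * int n + int x)) = num i x"
    and "i < k \<Longrightarrow> x < n \<Longrightarrow> m (5 + 4 * int (length es) + 2 * (int i * int n + int x)) = den i x"
  using assms by (simp_all add: input_ok_def)

abbreviation marks :: "int set" where
  "marks \<equiv> range mark_cell"

abbreviation E :: "(nat \<times> nat) set" where
  "E \<equiv> set es"

lemma H_pos: "1 \<le> H"
  using size_bounds by linarith

lemma mark_exp_val: "val e m = int x \<Longrightarrow> val (mark_exp e) m = mark_cell x"
  by (simp add: mark_cell_def)

section \<open>Marking the tail side of an arc\<close>

lemma wp_clear_marks:
  assumes "bounded_memory H m" "input_ok m" "n \<le> s"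
  shows "wp H s clear_marks m (\<lambda>m'. frame (insert (- 5) marks) m m' \<and> (\<forall>x<n. m' (mark_cell x) = 0))"
  unfolding clear_marks_def
proof (rule wp_For[where n = n and
      Inv = "\<lambda>j m'. frame (insert (- 5) marks) m m' \<and> (\<forall>x<j. m' (mark_cell x) = 0)"])
  fix j m' assume j: "j < n" and m': "bounded_memory H m'" "m' (- 5) = int j"
    and inv: "frame (insert (- 5) marks) m m' \<and> (\<forall>x<j. m' (mark_cell x) = 0)"
  have a: "val (mark_exp (var (- 5))) m' = mark_cell j" using m' by (intro mark_exp_val) simp
  show "wp H s (Store (mark_exp (var (- 5))) (Const 0)) m'
     (\<lambda>m''. m'' (- 5) = int j \<and> frame (insert (- 5) marks) m (m''(- 5 := int (Suc j))) \<and>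
       (\<forall>x<Suc j. (m''(- 5 := int (Suc j))) (mark_cell x) = 0))"
    by (rule wp_Store, rule m', use H_pos in simp, unfold a)
       (use m' inv in \<open>auto simp: less_Suc_eq frame_def\<close>)
qed (use assms size_bounds in \<open>auto simp: frame_def input_ok_def\<close>)

text \<open>Reachability in a finite relation needs no more steps than the relation has pairs, and
  the restricted relation has at most one per listed arc.\<close>

lemma side_rounds: "side E u v \<subseteq> (\<Union>r\<le>length es. ({(x, y) \<in> E. y \<noteq> v} ^^ r) `` {u})"
proof -
  let ?R = "{(x, y) \<in> E. y \<noteq> v}"
  have "finite ?R" by (rule finite_subset[of _ E]) auto
  moreover have "card ?R \<le> length es"
    using card_mono[of E ?R] card_length[of es] by (auto intro: le_trans)
  ultimately show ?thesis
    unfolding side_def using rtrancl_finite_eq_relpow[of ?R] by fastforce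
qed

lemma side_less: "u < n \<Longrightarrow> side E u v \<subseteq> {..<n}"
proof
  fix x assume "u < n" "x \<in> side E u v"
  from this(2) show "x \<in> {..<n}"
    by (induction rule: side_induct)
       (use \<open>u < n\<close> arcs in \<open>auto simp: in_set_conv_nth\<close>)
qed

definition marked :: "memory \<Rightarrow> nat set \<Rightarrow> bool" where
  "marked m S \<longleftrightarrow> (\<forall>x<n. m (mark_cell x) = of_bool (x \<in> S))"

text \<open>Marks set earlier in a round may already be used later in it, so the outcome depends on
  the order of the arcs. It is only enclosed: all allowed successors of \<open>S\<close> are marked,
  and nothing outside the side.\<close>

lemma wp_propagate_marks:
  assumes m: "bounded_memory H m" "input_ok m" and a: "m (- 2) = int a" "a < length es"
    and uv: "es ! a = (u, v)" and S: "marked m S" "S \<subseteq> side E u v"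
  shows "wp H s propagate_marks m (\<lambda>m'. frame (insert (- 4) marks) m m' \<and>
     (\<exists>T. marked m' T \<and> S \<subseteq> T \<and> T \<subseteq> side E u v \<and> (\<forall>(x, y) \<in> E. x \<in> S \<longrightarrow> y \<noteq> v \<longrightarrow> y \<in> T)))"
proof -
  let ?Inv = "\<lambda>j m'. frame (insert (- 4) marks) m m' \<and>
     (\<exists>T. marked m' T \<and> S \<subseteq> T \<and> T \<subseteq> side E u v \<and>
       (\<forall>i<j. fst (es ! i) \<in> S \<longrightarrow> snd (es ! i) \<noteq> v \<longrightarrow> snd (es ! i) \<in> T))"
  show ?thesis
    unfolding propagate_marks_def
  proof (rule wp_For[where n = "length es" and Inv = ?Inv])
    show "?Inv 0 (m(- 4 := 0))" using S by (auto simp: frame_def marked_def)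
    fix j m' assume "?Inv j m'"
    then show "val (var 2) m' = int (length es)"
      using input_okD[OF m(2)] by (auto simp: frame_def)
  next
    fix j m' assume j: "j < length es" and m': "bounded_memory H m'" "m' (- 4) = int j" and inv: "?Inv j m'"
    then obtain T where T: "marked m' T" "S \<subseteq> T" "T \<subseteq> side E u v"
      and old: "\<forall>i<j. fst (es ! i) \<in> S \<longrightarrow> snd (es ! i) \<noteq> v \<longrightarrow> snd (es ! i) \<in> T" by blast
    have fr: "frame (insert (- 4) marks) m m'" using inv by blast
    have ok: "input_ok m'" by (rule input_ok_frame[OF m(2) fr]) (auto simp: mark_cell_def)
    obtain x y where xy: "es ! j = (x, y)" by force
    have "(x, y) \<in> E" using nth_mem[OF j] xy by simp
    have range: "x < n" "y < n" using arcs \<open>(x, y) \<in> E\<close> by auto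
    have "m' (- 2) = int a" using frame_outside[OF fr, of "- 2"] a by auto
    then have vals: "val (head_exp (- 4)) m' = int y" "val (head_exp (- 2)) m' = int v"
      "val (mark_exp (tail_exp (- 4))) m' = mark_cell x" "val (mark_exp (head_exp (- 4))) m' = mark_cell y"
      using input_okD(4,5)[OF ok j] input_okD(5)[OF ok a(2)] xy uv m'(2)
      by (simp_all add: mark_cell_def)
    have guard: "val (Mul (Load (mark_exp (tail_exp (- 4))))
         (Mul (Sub (head_exp (- 4)) (head_exp (- 2))) (Sub (head_exp (- 4)) (head_exp (- 2))))) m'
       = of_bool (x \<in> T) * ((int y - int v) * (int y - int v))"
    proof -
      have "m' (mark_cell x) = of_bool (x \<in> T)" using T(1) range by (simp add: marked_def)
      then show ?thesis
        by (simp only: val.simps(5)[of "Load (mark_exp (tail_exp (- 4)))"]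
            val.simps(5)[of "Sub (head_exp (- 4)) (head_exp (- 2))"] val.simps(4)[of "head_exp (- 4)"]
            val.simps(2)[of "mark_exp (tail_exp (- 4))"] vals)
    qed
    show "wp H s (IfPos (Mul (Load (mark_exp (tail_exp (- 4))))
         (Mul (Sub (head_exp (- 4)) (head_exp (- 2))) (Sub (head_exp (- 4)) (head_exp (- 2)))))
         (Store (mark_exp (head_exp (- 4))) (Const 1)) Skip) m'
       (\<lambda>m''. m'' (- 4) = int j \<and> ?Inv (Suc j) (m''(- 4 := int (Suc j))))"
    proof (rule wp_IfPos, rule m', unfold guard)
      assume "0 < of_bool (x \<in> T) * ((int y - int v) * (int y - int v))"
      then have "x \<in> T" "y \<noteq> v" by (auto split: if_splits simp: of_bool_def)
      then have "y \<in> side E u v" using T(3) \<open>(x, y) \<in> E\<close> side_step by (metis subsetD)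
      then have "?Inv (Suc j) (m'(mark_cell y := 1, - 4 := int (Suc j)))"
        using T old xy fr
        by (intro conjI exI[of _ "insert y T"]) (auto simp: less_Suc_eq frame_def marked_def)
      then show "wp H s (Store (mark_exp (head_exp (- 4))) (Const 1)) m'
         (\<lambda>m''. m'' (- 4) = int j \<and> ?Inv (Suc j) (m''(- 4 := int (Suc j))))"
        using m' H_pos by (intro wp_Store) (simp_all add: vals del: val.simps(2-5))
    next
      assume "of_bool (x \<in> T) * ((int y - int v) * (int y - int v)) \<le> 0"
      then have "x \<notin> T \<or> y = v"
        by (auto simp: of_bool_def mult_le_0_iff split: if_splits)
      \<comment> \<open>An arc with tail in \<open>S\<close> has its tail in \<open>T\<close>, so it
        can only have failed the test because its head is \<open>v\<close>.\<close>
      then have "?Inv (Suc j) (m'(- 4 := int (Suc j)))"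
        using T old xy fr by (intro conjI exI[of _ T]) (auto simp: less_Suc_eq frame_def marked_def)
      then show "wp H s Skip m' (\<lambda>m''. m'' (- 4) = int j \<and> ?Inv (Suc j) (m''(- 4 := int (Suc j))))"
        using m' by (intro wp_Skip) simp_all
    qed
  next
    fix m' assume "?Inv (length es) m'"
    then obtain T where T: "frame (insert (- 4) marks) m m'" "marked m' T" "S \<subseteq> T" "T \<subseteq> side E u v"
      and closed: "\<forall>i<length es. fst (es ! i) \<in> S \<longrightarrow> snd (es ! i) \<noteq> v \<longrightarrow> snd (es ! i) \<in> T"
      by blast
    have "\<forall>(x, y) \<in> E. x \<in> S \<longrightarrow> y \<noteq> v \<longrightarrow> y \<in> T"
      using closed by (metis (mono_tags, lifting) case_prodI2 fst_conv in_set_conv_nth snd_conv)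
    with T show "frame (insert (- 4) marks) m m' \<and>
     (\<exists>T. marked m' T \<and> S \<subseteq> T \<and> T \<subseteq> side E u v \<and> (\<forall>(x, y) \<in> E. x \<in> S \<longrightarrow> y \<noteq> v \<longrightarrow> y \<in> T))"
      by blast
  qed (use m size_bounds in auto)
qed

text \<open>After \<open>r\<close> rounds everything within \<open>r\<close> steps of
  \<open>u\<close> is marked and nothing outside the side; by \<open>side_rounds\<close> the two
  bounds meet after the last round.\<close>

lemma wp_mark_side:
  assumes m: "bounded_memory H m" "input_ok m" and a: "m (- 2) = int a" "a < length es"
    and uv: "es ! a = (u, v)" and clear: "\<forall>x<n. m (mark_cell x) = 0"
  shows "wp H s mark_side m (\<lambda>m'. frame (insert (- 3) (insert (- 4) marks)) m m' \<and> marked m' (side E u v))"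
proof -
  let ?W = "insert (- 3) (insert (- 4) marks)"
  let ?R = "{(x, y) \<in> E. y \<noteq> v}"
  let ?Inv = "\<lambda>r m'. frame ?W m m' \<and>
     (\<exists>S. marked m' S \<and> S \<subseteq> side E u v \<and> (\<forall>i\<le>r. (?R ^^ i) `` {u} \<subseteq> S))"
  have u: "val (mark_exp (tail_exp (- 2))) m = mark_cell u"
    using input_okD(4)[OF m(2) a(2)] a uv by (simp add: mark_cell_def)
  have neg: "x < 0" if "x \<in> ?W" for x using that by (auto simp: mark_cell_def)
  let ?m = "m(mark_cell u := 1)"
  have b: "bounded_memory H ?m" using m(1) H_pos by (auto simp: bounded_memory_def)
  have "wp H s (For (- 3) (var 2) propagate_marks) ?m (\<lambda>m'. frame ?W m m' \<and> marked m' (side E u v))"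
  proof (rule wp_For[where n = "length es" and Inv = ?Inv])
    show "?Inv 0 (?m(- 3 := 0))"
      using clear by (intro conjI exI[of _ "{u}"]) (auto simp: frame_def marked_def side_self)
    fix j m' assume "?Inv j m'"
    then show "val (var 2) m' = int (length es)"
      using input_okD[OF m(2)] by (auto simp: frame_def)
  next
    fix r m' assume r: "r < length es" and m': "bounded_memory H m'" "m' (- 3) = int r" and inv: "?Inv r m'"
    then obtain S where S: "marked m' S" "S \<subseteq> side E u v" "\<forall>i\<le>r. (?R ^^ i) `` {u} \<subseteq> S" by blast
    have fr: "frame ?W m m'" using inv by blast
    have ok: "input_ok m'" by (rule input_ok_frame[OF m(2) fr neg])
    have "m' (- 2) = int a" using frame_outside[OF fr, of "- 2"] a by auto
    from wp_propagate_marks[OF m'(1) ok this a(2) uv S(1,2)]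
    show "wp H s propagate_marks m' (\<lambda>m''. m'' (- 3) = int r \<and> ?Inv (Suc r) (m''(- 3 := int (Suc r))))"
    proof (rule wp_mono)
      fix m'' assume "frame (insert (- 4) marks) m' m'' \<and>
        (\<exists>T. marked m'' T \<and> S \<subseteq> T \<and> T \<subseteq> side E u v \<and> (\<forall>(x, y) \<in> E. x \<in> S \<longrightarrow> y \<noteq> v \<longrightarrow> y \<in> T))"
      then obtain T where fr': "frame (insert (- 4) marks) m' m''" and T: "marked m'' T" "S \<subseteq> T"
        "T \<subseteq> side E u v" "\<forall>(x, y) \<in> E. x \<in> S \<longrightarrow> y \<noteq> v \<longrightarrow> y \<in> T" by blast
      have "m'' (- 3) = int r" using frame_outside[OF fr', of "- 3"] m'(2) by auto
      moreover have "frame ?W m (m''(- 3 := int (Suc r)))"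
        by (rule frame_upd[OF frame_trans[OF fr fr']]) auto
      moreover have "(?R ^^ i) `` {u} \<subseteq> T" if "i \<le> Suc r" for i
      proof (cases "i = Suc r")
        case True
        then show ?thesis using S(3) T(4) by fastforce
      next
        case False
        then have "(?R ^^ i) `` {u} \<subseteq> S" using S(3) that by simp
        then show ?thesis using T(2) by blast
      qed
      moreover have "marked (m''(- 3 := int (Suc r))) T" using T(1) by (simp add: marked_def)
      ultimately show "m'' (- 3) = int r \<and> ?Inv (Suc r) (m''(- 3 := int (Suc r)))"
        using T(3) by blast
    qed
  next
    fix m' assume "?Inv (length es) m'"
    then obtain S where "frame ?W m m'" "marked m' S" "S \<subseteq> side E u v"
      "\<forall>i\<le>length es. (?R ^^ i) `` {u} \<subseteq> S" by blast
    moreover from this have "S = side E u v" using side_rounds[of u v] by blast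
    ultimately show "frame ?W m m' \<and> marked m' (side E u v)" by simp
  qed (use b size_bounds in auto)
  then show ?thesis
    unfolding mark_side_def by (intro wp_Seq wp_Store) (use m H_pos in \<open>simp_all add: u del: val.simps(2-5)\<close>)
qed


section \<open>Comparing the supplies of a side and its complement\<close>

definition balance :: "nat \<Rightarrow> nat set \<Rightarrow> nat \<Rightarrow> real" where
  "balance i S j = (\<Sum>x<j. (if x \<in> S then 1 else - 1) * (real_of_int (num i x) / real_of_int (den i x)))"

text \<open>The accumulated fraction equals \<open>balance\<close> and its denominator is positive,
  so the sign of the numerator decides, without any division.\<close>

lemma wp_compare_supplies:
  assumes m: "bounded_memory H m" "input_ok m" and i: "m (- 1) = int i" "i < k" and S: "marked m S"
  shows "wp H s compare_supplies m (\<lambda>m'. frame {- 8..- 5} m m' \<and> m' (- 8) = int (card (S \<inter> {..<n})) \<and>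
     (m' (- 6) < 0 \<longleftrightarrow> balance i S n < 0))"
    (is "wp H s _ m ?Q")
proof -
  \<comment> \<open>Keeps the bit length of the accumulated fraction below that of the input.\<close>
  let ?P = "\<lambda>j. \<Prod>x<j. \<bar>num i x\<bar> + den i x"
  let ?Inv = "\<lambda>j m'. frame {- 8..- 5} m m' \<and> m' (- 8) = int (card (S \<inter> {..<j})) \<and> 0 < m' (- 7) \<and>
     \<bar>m' (- 6)\<bar> + m' (- 7) \<le> ?P j \<and> real_of_int (m' (- 6)) = real_of_int (m' (- 7)) * balance i S j"
  have loop: "wp H s (For (- 5) (var 1)
       (Seq (Store (Const (- 6)) (Add (Mul (var (- 6)) (supply_exp 5))
           (Mul (Sub (Mul (Const 2) (Load (mark_exp (var (- 5))))) (Const 1))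
             (Mul (var (- 7)) (supply_exp 4)))))
       (Seq (Store (Const (- 7)) (Mul (var (- 7)) (supply_exp 5)))
         (Store (Const (- 8)) (Add (var (- 8)) (Load (mark_exp (var (- 5)))))))))
     (m(- 6 := 0, - 7 := 1, - 8 := 0)) ?Q"
  proof (rule wp_For[where n = n and Inv = ?Inv])
    show "bounded_memory H (m(- 6 := 0, - 7 := 1, - 8 := 0))"
      using m H_pos by (auto simp: bounded_memory_def)
    show "?Inv 0 ((m(- 6 := 0, - 7 := 1, - 8 := 0))(- 5 := 0))"
      by (auto simp: frame_def balance_def)
    show "val (var 1) m' = int n" if "?Inv j m'" for j m'
      using that input_okD(1)[OF m(2)] by (auto simp: frame_def)
    show "?Q m'" if "?Inv n m'" for m'
    proof -
      have "m' (- 6) < 0 \<longleftrightarrow> real_of_int (m' (- 6)) < 0" by simp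
      also have "\<dots> \<longleftrightarrow> balance i S n < 0" using that by (auto simp: mult_less_0_iff)
      finally show ?thesis using that by simp
    qed
    show "n \<le> s" "int n \<le> H" using size_bounds i by auto
  next
    fix j m' assume j: "j < n" and m': "bounded_memory H m'" "m' (- 5) = int j" and inv: "?Inv j m'"
    define p q where "p = m' (- 6)" and "q = m' (- 7)"
    define d \<nu> where "d = den i j" and "\<nu> = num i j"
    define \<sigma> :: int where "\<sigma> = (if j \<in> S then 1 else - 1)"
    have fr: "frame {- 8..- 5} m m'" using inv by blast
    have ok: "input_ok m'" by (rule input_ok_frame[OF m(2) fr]) auto
    have "m' (- 1) = int i" using frame_outside[OF fr, of "- 1"] i by simp
    have mk: "m' (- 21 - 2 * int j) = of_bool (j \<in> S)"
      using frame_outside[OF fr, of "mark_cell j"] S j by (simp add: marked_def mark_cell_def)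
    note facts = input_okD(1,2)[OF ok] input_okD(6,7)[OF ok i(2) j] \<open>m' (- 1) = int i\<close> m'(2) mk
    \<comment> \<open>The distance between a denominator cell and cell \<open>-6\<close>: the store
      to \<open>-6\<close> does not change the denominator that is read next.\<close>
    have "0 \<le> int i * int n" by simp
    then have nonzero: "11 + (4 * int (length es) + (2 * (int i * int n) + 2 * int j)) \<noteq> 0" by linarith
    let ?p = "p * d + \<sigma> * (q * \<nu>)" and ?q = "q * d" and ?c = "int (card (S \<inter> {..<Suc j}))"
    have pos: "0 < d" "0 < q" using den_pos[OF i(2) j] inv by (auto simp: d_def q_def)
    have "\<bar>p * d\<bar> = \<bar>p\<bar> * d" "\<bar>\<sigma> * (q * \<nu>)\<bar> = q * \<bar>\<nu>\<bar>"
      using pos by (simp_all add: abs_mult \<sigma>_def)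
    then have "\<bar>?p\<bar> \<le> \<bar>p\<bar> * d + q * \<bar>\<nu>\<bar>"
      using abs_triangle_ineq[of "p * d" "\<sigma> * (q * \<nu>)"] by linarith
    \<comment> \<open>Of the four terms of the expanded product, three bound the new numerator and
      denominator; this one is slack.\<close>
    moreover have "0 \<le> \<bar>p\<bar> * \<bar>\<nu>\<bar>" by simp
    moreover have "(\<bar>p\<bar> + q) * (\<bar>\<nu>\<bar> + d) = \<bar>p\<bar> * \<bar>\<nu>\<bar> + \<bar>p\<bar> * d + q * \<bar>\<nu>\<bar> + q * d"
      by (simp add: algebra_simps)
    ultimately have "\<bar>?p\<bar> + ?q \<le> (\<bar>p\<bar> + q) * (\<bar>\<nu>\<bar> + d)"
      by linarith
    also have "\<dots> \<le> ?P j * (\<bar>\<nu>\<bar> + d)"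
      using inv pos by (intro mult_right_mono) (auto simp: p_def q_def)
    also have "\<dots> = ?P (Suc j)" by (simp add: \<nu>_def d_def)
    finally have bound: "\<bar>?p\<bar> + ?q \<le> ?P (Suc j)" .
    moreover have "?P (Suc j) \<le> H" using prod_bound[OF i(2)] j by (metis Suc_leI)
    moreover have "0 < ?q" using pos by simp
    ultimately have le: "\<bar>?p\<bar> \<le> H" "\<bar>?q\<bar> \<le> H" by linarith+
    have c: "m' (- 8) + of_bool (j \<in> S) = ?c"
      using inv by (auto simp: lessThan_Suc Int_insert_right)
    have "card (S \<inter> {..<Suc j}) \<le> n"
      using j card_mono[of "{..<n}" "S \<inter> {..<Suc j}"] by force
    then have cle: "\<bar>?c\<bar> \<le> H" using size_bounds by linarith
    let ?m = "m'(- 6 := ?p, - 7 := ?q, - 8 := ?c, - 5 := int (Suc j))"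
    have "real_of_int ?p = real_of_int ?q * balance i S (Suc j)"
    proof -
      have old: "real_of_int p = real_of_int q * balance i S j" using inv by (simp add: p_def q_def)
      have new: "balance i S (Suc j) = balance i S j + real_of_int \<sigma> * (real_of_int \<nu> / real_of_int d)"
        by (simp add: balance_def \<sigma>_def \<nu>_def d_def)
      show ?thesis unfolding new of_int_add of_int_mult old using pos by (simp add: field_simps)
    qed
    moreover have "frame {- 8..- 5} m ?m" using fr by (auto simp: frame_def)
    ultimately have "?Inv (Suc j) ?m" using bound \<open>0 < ?q\<close> by simp
    then show "wp H s (Seq (Store (Const (- 6)) (Add (Mul (var (- 6)) (supply_exp 5))
           (Mul (Sub (Mul (Const 2) (Load (mark_exp (var (- 5))))) (Const 1))
             (Mul (var (- 7)) (supply_exp 4)))))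
       (Seq (Store (Const (- 7)) (Mul (var (- 7)) (supply_exp 5)))
         (Store (Const (- 8)) (Add (var (- 8)) (Load (mark_exp (var (- 5)))))))) m'
      (\<lambda>m''. m'' (- 5) = int j \<and> ?Inv (Suc j) (m''(- 5 := int (Suc j))))"
    proof (rule_tac wp_Store_Seq[where x = "- 6" and z = ?p])
      assume 1: "bounded_memory H (m'(- 6 := ?p))" and inv': "?Inv (Suc j) ?m"
      show "wp H s (Seq (Store (Const (- 7)) (Mul (var (- 7)) (supply_exp 5)))
         (Store (Const (- 8)) (Add (var (- 8)) (Load (mark_exp (var (- 5))))))) (m'(- 6 := ?p))
        (\<lambda>m''. m'' (- 5) = int j \<and> ?Inv (Suc j) (m''(- 5 := int (Suc j))))"
      proof (rule wp_Store_Seq[where x = "- 7" and z = ?q, OF 1])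
        assume 2: "bounded_memory H (m'(- 6 := ?p, - 7 := ?q))"
        show "wp H s (Store (Const (- 8)) (Add (var (- 8)) (Load (mark_exp (var (- 5))))))
          (m'(- 6 := ?p, - 7 := ?q)) (\<lambda>m''. m'' (- 5) = int j \<and> ?Inv (Suc j) (m''(- 5 := int (Suc j))))"
          by (rule wp_Store_val[where x = "- 8" and z = ?c, OF 2]) (use facts c cle inv' m'(2) in simp_all)
      qed (use facts le nonzero in \<open>simp_all add: q_def d_def\<close>)
    qed (use m' facts le in \<open>simp_all add: p_def q_def d_def \<nu>_def \<sigma>_def\<close>)
  qed
  have H0: "\<bar>0\<bar> \<le> H" "\<bar>1\<bar> \<le> H" using H_pos by simp_all
  show ?thesis
    unfolding compare_supplies_def
    by (rule wp_Store_Seq[where x = "- 6" and z = 0], rule m, simp, simp, rule H0,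
        rule wp_Store_Seq[where x = "- 7" and z = 1], assumption, simp, simp, rule H0,
        rule wp_Store_Seq[where x = "- 8" and z = 0], assumption, simp, simp, rule H0, rule loop)
qed

section \<open>The search for a smallest heavy side\<close>

abbreviation tail_side :: "nat \<Rightarrow> nat set" where
  "tail_side j \<equiv> side E (fst (es ! j)) (snd (es ! j))"

text \<open>The state after \<open>a\<close> arcs, with tail \<open>b\<close> and size
  \<open>c\<close>. The default \<open>c = n\<close> does not by itself say that no side is heavy;
  it does in a tree, where every side of an arc omits the head.\<close>

definition smallest_heavy :: "nat \<Rightarrow> nat \<Rightarrow> nat \<Rightarrow> nat \<Rightarrow> bool" where
  "smallest_heavy i a b c \<longleftrightarrow>
     (\<forall>j<a. balance i (tail_side j) n < 0 \<longrightarrow> c \<le> card (tail_side j)) \<and>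
     (c = n \<and> b = 0 \<or>
       (\<exists>j<a. balance i (tail_side j) n < 0 \<and> b = fst (es ! j) \<and> c = card (tail_side j)))"

lemma wp_arc_body:
  assumes m: "bounded_memory H m" "input_ok m" and i: "m (- 1) = int i" "i < k"
    and a: "m (- 2) = int a" "a < length es"
    and best: "m (- 9) = int b" "m (- 10) = int c" "smallest_heavy i a b c"
  shows "wp H s (Seq clear_marks (Seq mark_side (Seq compare_supplies update_best))) m
    (\<lambda>m'. frame ({- 10..- 3} \<union> marks) m m' \<and>
      (\<exists>b c. m' (- 9) = int b \<and> m' (- 10) = int c \<and> smallest_heavy i (Suc a) b c))"
    (is "wp H s _ m ?Q")
proof -
  let ?W = "{- 10..- 3} \<union> marks"
  obtain u v where uv: "es ! a = (u, v)" by force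
  let ?S = "side E u v"
  have "u < n" using arcs[of u v] nth_mem[OF a(2)] uv by simp
  then have S: "?S \<inter> {..<n} = ?S" "card ?S \<le> n"
    using side_less[of u v] card_mono[of "{..<n}" ?S] by auto
  have update: "wp H s update_best m' ?Q"
    if m': "bounded_memory H m'" and fr: "frame ({- 8..- 3} \<union> marks) m m'"
      and c': "m' (- 8) = int (card ?S)" and p: "m' (- 6) < 0 \<longleftrightarrow> balance i ?S n < 0" for m'
  proof -
    have ok: "input_ok m'" by (rule input_ok_frame[OF m(2) fr]) (auto simp: mark_cell_def)
    have regs: "m' (- 2) = int a" "m' (- 9) = int b" "m' (- 10) = int c"
      using frame_outside[OF fr] a best by simp_all
    have t: "val (tail_exp (- 2)) m' = int u"
      using input_okD(4)[OF ok a(2)] uv regs by simp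
    have fr': "frame ?W m m'" using fr by (auto simp: frame_def)
    \<comment> \<open>This includes a heavy side that is not smaller than \<open>c\<close>, for
      which \<open>c\<close> remains a lower bound.\<close>
    have keep: "?Q m'" if "\<not> (balance i ?S n < 0 \<and> card ?S < c)"
    proof -
      have "smallest_heavy i (Suc a) b c"
        using best(3) that uv unfolding smallest_heavy_def less_Suc_eq by auto
      then show ?thesis using regs fr' by blast
    qed
    have switch: "?Q (m'(- 9 := int u, - 10 := int (card ?S)))" if less: "balance i ?S n < 0" "card ?S < c"
    proof -
      have "smallest_heavy i (Suc a) u (card ?S)"
        unfolding smallest_heavy_def
      proof (intro conjI disjI2 exI[of _ a])
        show "\<forall>j<Suc a. balance i (tail_side j) n < 0 \<longrightarrow> card ?S \<le> card (tail_side j)"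
          using best(3) less uv unfolding smallest_heavy_def less_Suc_eq by fastforce
      qed (use less uv in auto)
      moreover have "frame ?W m (m'(- 9 := int u, - 10 := int (card ?S)))"
        using fr' by (simp add: frame_def)
      moreover have "(m'(- 9 := int u, - 10 := int (card ?S))) (- 9) = int u"
        "(m'(- 9 := int u, - 10 := int (card ?S))) (- 10) = int (card ?S)" by simp_all
      ultimately show ?thesis by blast
    qed
    show ?thesis
      unfolding update_best_def
    proof (intro wp_IfPos m')
      assume 1: "0 < val (Sub (Const 0) (var (- 6))) m'" "0 < val (Sub (var (- 10)) (var (- 8))) m'"
      then have "?Q (m'(- 9 := int u, - 10 := int (card ?S)))"
        using p c' regs by (intro switch) simp_all
      then show "wp H s (Seq (Store (Const (- 9)) (tail_exp (- 2))) (Store (Const (- 10)) (var (- 8)))) m' ?Q"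
      proof (rule_tac wp_Store_Seq[where x = "- 9" and z = "int u"])
        assume "bounded_memory H (m'(- 9 := int u))"
          and "?Q (m'(- 9 := int u, - 10 := int (card ?S)))"
        then show "wp H s (Store (Const (- 10)) (var (- 8))) (m'(- 9 := int u)) ?Q"
          by (rule_tac wp_Store_val[where x = "- 10" and z = "int (card ?S)"])
             (use c' S(2) size_bounds in simp_all)
      qed (use m' t \<open>u < n\<close> size_bounds in simp_all)
    next
      assume "0 < val (Sub (Const 0) (var (- 6))) m'" "val (Sub (var (- 10)) (var (- 8))) m' \<le> 0"
      then show "wp H s Skip m' ?Q" using c' regs by (intro wp_Skip m' keep) simp
    next
      assume "val (Sub (Const 0) (var (- 6))) m' \<le> 0"
      then show "wp H s Skip m' ?Q" using p by (intro wp_Skip m' keep) simp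
    qed
  qed
  have n: "n \<le> s" using size_bounds i by auto
  show ?thesis
  proof (rule wp_Seq, rule wp_mono[OF wp_clear_marks[OF m n]])
    fix m1 assume m1: "bounded_memory H m1"
      and post1: "frame (insert (- 5) marks) m m1 \<and> (\<forall>x<n. m1 (mark_cell x) = 0)"
    then have fr1: "frame (insert (- 5) marks) m m1" by blast
    have ok1: "input_ok m1" by (rule input_ok_frame[OF m(2) fr1]) (auto simp: mark_cell_def)
    have a1: "m1 (- 2) = int a" using frame_outside[OF fr1] a by simp
    show "wp H s (Seq mark_side (Seq compare_supplies update_best)) m1 ?Q"
    proof (rule wp_Seq, rule wp_mono[OF wp_mark_side[OF m1 ok1 a1 a(2) uv]])
      show "\<forall>x<n. m1 (mark_cell x) = 0" using post1 by blast
    next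
      fix m2 assume m2: "bounded_memory H m2"
        and post2: "frame (insert (- 3) (insert (- 4) marks)) m1 m2 \<and> marked m2 ?S"
      then have fr2: "frame ({- 5..- 3} \<union> marks) m m2"
        using fr1 by (auto simp: frame_def)
      have ok2: "input_ok m2" by (rule input_ok_frame[OF m(2) fr2]) (auto simp: mark_cell_def)
      have i2: "m2 (- 1) = int i" using frame_outside[OF fr2] i by simp
      show "wp H s (Seq compare_supplies update_best) m2 ?Q"
      proof (rule wp_Seq, rule wp_mono[OF wp_compare_supplies[OF m2 ok2 i2 i(2)]])
        show "marked m2 ?S" using post2 by blast
      next
        fix m3 assume "bounded_memory H m3"
          and "frame {- 8..- 5} m2 m3 \<and> m3 (- 8) = int (card (?S \<inter> {..<n})) \<and>
            (m3 (- 6) < 0 \<longleftrightarrow> balance i ?S n < 0)"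
        then show "wp H s update_best m3 ?Q"
          using fr2 by (intro update) (auto simp: frame_def S)
      qed
    qed
  qed
qed

lemma wp_find_centroid:
  assumes m: "bounded_memory H m" "input_ok m" and i: "m (- 1) = int i" "i < k"
  shows "wp H s find_centroid m (\<lambda>m'. frame ({- 10..- 2} \<union> marks) m m' \<and>
    (\<exists>b c. m' (- 9) = int b \<and> smallest_heavy i (length es) b c))"
    (is "wp H s _ m ?Q")
proof -
  let ?W = "{- 10..- 2} \<union> marks"
  have neg: "x < 0" if "x \<in> ?W" for x using that by (auto simp: mark_cell_def)
  let ?Inv = "\<lambda>a m'. frame ?W m m' \<and>
     (\<exists>b c. m' (- 9) = int b \<and> m' (- 10) = int c \<and> smallest_heavy i a b c)"
  have loop: "wp H s (For (- 2) (var 2) (Seq clear_marks (Seq mark_side (Seq compare_supplies update_best))))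
    (m(- 9 := 0, - 10 := int n)) ?Q"
  proof (rule wp_For[where n = "length es" and Inv = ?Inv])
    show "bounded_memory H (m(- 9 := 0, - 10 := int n))"
      using m H_pos size_bounds by (auto simp: bounded_memory_def)
    show "?Inv 0 ((m(- 9 := 0, - 10 := int n))(- 2 := 0))"
      by (intro conjI exI[of _ 0] exI[of _ n]) (auto simp: frame_def smallest_heavy_def)
    show "val (var 2) m' = int (length es)" if "?Inv a m'" for a m'
      using that input_okD(2)[OF m(2)] by (auto simp: frame_def)
  next
    fix a m' assume a: "a < length es" and m': "bounded_memory H m'" "m' (- 2) = int a" and inv: "?Inv a m'"
    then obtain b c where best: "m' (- 9) = int b" "m' (- 10) = int c" "smallest_heavy i a b c" by blast
    have fr: "frame ?W m m'" using inv by blast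
    have ok: "input_ok m'" by (rule input_ok_frame[OF m(2) fr neg])
    have i': "m' (- 1) = int i" using frame_outside[OF fr] i by simp
    show "wp H s (Seq clear_marks (Seq mark_side (Seq compare_supplies update_best))) m'
      (\<lambda>m''. m'' (- 2) = int a \<and> ?Inv (Suc a) (m''(- 2 := int (Suc a))))"
    proof (rule wp_mono[OF wp_arc_body[OF m'(1) ok i' i(2) m'(2) a best]])
      fix m'' assume "frame ({- 10..- 3} \<union> marks) m' m'' \<and>
        (\<exists>b c. m'' (- 9) = int b \<and> m'' (- 10) = int c \<and> smallest_heavy i (Suc a) b c)"
      moreover from this have "frame ?W m (m''(- 2 := int (Suc a)))"
        using fr by (auto simp: frame_def)
      ultimately show "m'' (- 2) = int a \<and> ?Inv (Suc a) (m''(- 2 := int (Suc a)))"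
        using frame_outside[of "{- 10..- 3} \<union> marks" m' m'' "- 2"] m'(2) by simp
    qed
  qed (use size_bounds in auto)
  show ?thesis
    unfolding find_centroid_def
  proof (rule wp_Store_Seq[where x = "- 9" and z = 0], rule m)
    assume "bounded_memory H (m(- 9 := 0))"
    then show "wp H s (Seq (Store (Const (- 10)) (var 1)) (For (- 2) (var 2)
        (Seq clear_marks (Seq mark_side (Seq compare_supplies update_best))))) (m(- 9 := 0)) ?Q"
      by (rule wp_Store_Seq[where x = "- 10" and z = "int n"])
         (use input_okD(1)[OF m(2)] size_bounds loop in simp_all)
  qed (use H_pos in simp_all)
qed

text \<open>Until all commodities are done, only negative addresses are written, so the input stays
  intact for each of them.\<close>

lemma wp_lomuf_program:
  assumes m: "bounded_memory H m" "input_ok m"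
  shows "wp H s lomuf_program m (\<lambda>m'. m' 0 = int k \<and>
    (\<forall>i<k. \<exists>b c. m' (1 + int i) = int b \<and> smallest_heavy i (length es) b c))"
    (is "wp H s _ m ?Q")
proof -
  let ?Inv = "\<lambda>j m'. frame {..<0} m m' \<and>
     (\<forall>i<j. \<exists>b c. m' (result_cell i) = int b \<and> smallest_heavy i (length es) b c)"
  have ks: "k \<le> s" "int k \<le> H" using size_bounds by auto
  show ?thesis
    unfolding lomuf_program_def
  proof (rule wp_Seq, rule wp_For[where n = k and Inv = ?Inv])
    show "bounded_memory H m" by (rule m)
    show "?Inv 0 (m(- 1 := 0))" by (auto simp: frame_def)
    show "val (var 3) m' = int k" if "?Inv j m'" for j m'
      using that input_okD(3)[OF m(2)] by (auto simp: frame_def)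
  next
    fix i m' assume i: "i < k" and m': "bounded_memory H m'" "m' (- 1) = int i" and inv: "?Inv i m'"
    have fr: "frame {..<0} m m'" using inv by blast
    have ok: "input_ok m'" by (rule input_ok_frame[OF m(2) fr]) auto
    show "wp H s (Seq find_centroid (Store (result_exp (var (- 1))) (var (- 9)))) m'
      (\<lambda>m''. m'' (- 1) = int i \<and> ?Inv (Suc i) (m''(- 1 := int (Suc i))))"
    proof (rule wp_Seq, rule wp_mono[OF wp_find_centroid[OF m'(1) ok m'(2) i]])
      fix m'' assume m'': "bounded_memory H m''" and "frame ({- 10..- 2} \<union> marks) m' m'' \<and>
        (\<exists>b c. m'' (- 9) = int b \<and> smallest_heavy i (length es) b c)"
      then obtain b c where fr': "frame ({- 10..- 2} \<union> marks) m' m''"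
        and b: "m'' (- 9) = int b" "smallest_heavy i (length es) b c" by blast
      have i'': "m'' (- 1) = int i" using frame_outside[OF fr'] m'(2) by simp
      have "m'' (result_cell l) = m' (result_cell l)" for l
      proof -
        have "result_cell l \<le> - 20" by (simp add: result_cell_def)
        then show ?thesis using frame_outside[OF fr', of "result_cell l"] by simp
      qed
      moreover have "m'' x = m' x" if "0 \<le> x" for x
        using frame_outside[OF fr', of x] that by simp
      then have "frame {..<0} m (m''(result_cell i := int b, - 1 := int (Suc i)))"
        using fr by (auto simp: frame_def result_cell_def)
      ultimately have "?Inv (Suc i) (m''(result_cell i := int b, - 1 := int (Suc i)))"
        using inv b(2) by (auto simp: less_Suc_eq)
      then show "wp H s (Store (result_exp (var (- 1))) (var (- 9))) m''
        (\<lambda>m''. m'' (- 1) = int i \<and> ?Inv (Suc i) (m''(- 1 := int (Suc i))))"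
        using m'' b(1) i''
        by (intro wp_Store_val[where x = "result_cell i" and z = "int b"])
           (auto simp: bounded_memory_def result_cell_def[of i] dest: spec[of _ "- 9"])
    qed
  next
    fix m1 assume m1: "bounded_memory H m1" and inv: "?Inv k m1"
    have ok: "input_ok m1" by (rule input_ok_frame[OF m(2)]) (use inv in auto)
    \<comment> \<open>Copying destroys the input, so this invariant keeps only the saved results and
      the saved number of commodities.\<close>
    let ?I = "\<lambda>j m'. m' (- 11) = int k \<and> (\<forall>i<k. m' (result_cell i) = m1 (result_cell i)) \<and>
      (\<forall>i<j. m' (1 + int i) = m1 (result_cell i))"
    let ?m = "m1(- 11 := int k)"
    have copy: "wp H s (For (- 1) (var (- 11)) (Store (Add (Const 1) (var (- 1))) (Load (result_exp (var (- 1))))))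
      ?m (\<lambda>m'. bounded_memory H m' \<and> ?I k m')"
    proof (rule wp_For[where n = k and Inv = ?I])
      show "bounded_memory H ?m" using m1 ks by (simp add: bounded_memory_def)
    next
      fix j m' assume j: "j < k" and m': "bounded_memory H m'" "m' (- 1) = int j" and I: "?I j m'"
      have r: "m' (- 20 - 2 * int j) = m1 (result_cell j)" using I j by (simp add: result_cell_def)
      have "1 + int j \<noteq> result_cell l" "1 + int j \<noteq> - 1" for l by (simp_all add: result_cell_def)
      then have "?I (Suc j) (m'(1 + int j := m1 (result_cell j), - 1 := int (Suc j)))"
        using I by (auto simp: less_Suc_eq)
      then show "wp H s (Store (Add (Const 1) (var (- 1))) (Load (result_exp (var (- 1))))) m'
        (\<lambda>m''. m'' (- 1) = int j \<and> ?I (Suc j) (m''(- 1 := int (Suc j))))"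
        using m' m1 r
        by (intro wp_Store_val[where x = "1 + int j" and z = "m1 (result_cell j)"])
           (auto simp: bounded_memory_def)
    qed (use ks in auto)
    have "wp H s (Seq (For (- 1) (var (- 11)) (Store (Add (Const 1) (var (- 1))) (Load (result_exp (var (- 1))))))
        (Store (Const 0) (var (- 11)))) ?m ?Q"
    proof (rule wp_Seq, rule wp_mono[OF copy])
      fix m' assume "bounded_memory H m' \<and> ?I k m'"
      then show "wp H s (Store (Const 0) (var (- 11))) m' ?Q"
        using inv ks by (intro wp_Store_val[where x = 0 and z = "int k"]) auto
    qed
    then show "wp H s (Seq (Store (Const (- 11)) (var 3))
       (Seq (For (- 1) (var (- 11)) (Store (Add (Const 1) (var (- 1))) (Load (result_exp (var (- 1))))))
         (Store (Const 0) (var (- 11))))) m1 ?Q"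
      using m1 ks input_okD(3)[OF ok]
      by (intro wp_Store_Seq[where x = "- 11" and z = "int k"]) simp_all
  qed (use ks in auto)
qed

end

section \<open>Encoded instances\<close>

lemma length_concat_blocks:
  "(\<And>x. x \<in> set l \<Longrightarrow> length (f x) = c) \<Longrightarrow> length (concat (map f l)) = c * length l"
  by (induction l) auto

lemma nth_concat_blocks:
  assumes "\<And>x. x \<in> set l \<Longrightarrow> length (f x) = c" "j < length l" "r < c"
  shows "concat (map f l) ! (c * j + r) = f (l ! j) ! r"
  using assms
proof (induction l arbitrary: j)
  case (Cons x l)
  then show ?case by (cases j) (auto simp: nth_append)
qed simp

lemma length_encode_rat [simp]: "length (encode_rat r) = 2"
  by (simp add: encode_rat_def)

lemma length_encode_supply:
  "length (concat (map (\<lambda>v. encode_rat (f v)) [0..<n])) = 2 * n"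
  using length_concat_blocks[of "[0..<n]" "\<lambda>v. encode_rat (f v)" 2] by simp

lemma nth_encode_supply:
  "x < n \<Longrightarrow> r < 2 \<Longrightarrow> concat (map (\<lambda>v. encode_rat (f v)) [0..<n]) ! (2 * x + r) = encode_rat (f x) ! r"
  using nth_concat_blocks[of "[0..<n]" "\<lambda>v. encode_rat (f v)" 2 x r] by simp

lemma length_encode_instance:
  "length (encode_instance I) =
    3 + 4 * length (arc_list I) + 2 * num_verts I * length (supplies I)"
proof -
  have "length (concat (map (\<lambda>a. [int (fst a), int (snd a)] @ encode_rat (capacity I a)) (arc_list I)))
      = 4 * length (arc_list I)"
    by (rule length_concat_blocks) simp
  moreover have "length (concat (map (\<lambda>s. concat (map (\<lambda>v. encode_rat (s v)) [0..<num_verts I])) (supplies I)))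
      = 2 * num_verts I * length (supplies I)"
    by (rule length_concat_blocks) (rule length_encode_supply)
  ultimately show ?thesis by (simp only: encode_instance_def length_append) simp
qed

lemma nth_encode_arc:
  assumes "j < length (arc_list I)"
  shows "encode_instance I ! (3 + 4 * j) = int (fst (arc_list I ! j))"
    and "encode_instance I ! (4 + 4 * j) = int (snd (arc_list I ! j))"
proof -
  let ?f = "\<lambda>a. [int (fst a), int (snd a)] @ encode_rat (capacity I a)"
  let ?A = "concat (map ?f (arc_list I))"
  have len: "length ?A = 4 * length (arc_list I)" by (rule length_concat_blocks) simp
  have "encode_instance I ! (3 + (4 * j + r)) = ?f (arc_list I ! j) ! r" if "r < 4" for r
  proof -
    have "encode_instance I ! (3 + (4 * j + r)) = ?A ! (4 * j + r)"
      using assms that len unfolding encode_instance_def by (simp add: nth_append)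
    also have "\<dots> = ?f (arc_list I ! j) ! r"
      using assms that by (intro nth_concat_blocks) simp_all
    finally show ?thesis .
  qed
  from this[of 0] this[of 1]
  show "encode_instance I ! (3 + 4 * j) = int (fst (arc_list I ! j))"
    and "encode_instance I ! (4 + 4 * j) = int (snd (arc_list I ! j))"
    by simp_all
qed

lemma nth_encode_supplies:
  assumes "i < length (supplies I)" "x < num_verts I" "r < 2"
  shows "encode_instance I ! (3 + 4 * length (arc_list I) + (2 * (i * num_verts I + x) + r))
    = encode_rat ((supplies I ! i) x) ! r"
proof -
  let ?n = "num_verts I"
  let ?A = "concat (map (\<lambda>a. [int (fst a), int (snd a)] @ encode_rat (capacity I a)) (arc_list I))"
  let ?g = "\<lambda>s. concat (map (\<lambda>v. encode_rat (s v)) [0..<?n])"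
  let ?S = "concat (map ?g (supplies I))"
  have len: "length ?A = 4 * length (arc_list I)" by (rule length_concat_blocks) simp
  have "encode_instance I ! (3 + 4 * length (arc_list I) + (2 * (i * ?n + x) + r)) = ?S ! (2 * (i * ?n + x) + r)"
    using len unfolding encode_instance_def by (simp add: nth_append add.assoc)
  also have "\<dots> = ?S ! (2 * ?n * i + (2 * x + r))" by (simp add: algebra_simps)
  also have "\<dots> = ?g (supplies I ! i) ! (2 * x + r)"
    using assms by (intro nth_concat_blocks length_encode_supply) simp_all
  also have "\<dots> = encode_rat ((supplies I ! i) x) ! r"
    using assms by (intro nth_encode_supply)
  finally show ?thesis .
qed

section \<open>Bounds in terms of the input size\<close>

lemma input_memory_nth: "p < length xs \<Longrightarrow> input_memory xs (1 + int p) = xs ! p"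
  by (simp add: input_memory_def)

lemma input_size_append: "input_size (xs @ ys) = input_size xs + input_size ys"
  by (simp add: input_size_def)

lemma input_size_concat: "input_size (concat (map f l)) = (\<Sum>x\<leftarrow>l. input_size (f x))"
  by (induction l) (simp_all add: input_size_append, simp add: input_size_def)

lemma length_le_input_size: "length xs \<le> input_size xs"
  unfolding input_size_def
proof (induction xs)
  case (Cons x xs)
  then show ?case using int_size_pos[of x] by simp
qed simp

lemma abs_le_power_input_size: "x \<in> set xs \<Longrightarrow> \<bar>x\<bar> \<le> 2 ^ input_size xs"
proof -
  assume "x \<in> set xs"
  then have "int_size x \<le> input_size xs"
    unfolding input_size_def by (intro member_le_sum_list) auto
  then have "(2::int) ^ (int_size x - 1) \<le> 2 ^ input_size xs" by (intro power_increasing) auto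
  then show ?thesis using abs_less_power_int_size[of x] by linarith
qed

lemma bounded_input_memory: "bounded_memory (2 ^ input_size xs) (input_memory xs)"
  unfolding bounded_memory_def
proof
  fix p
  have "int (length xs) \<le> int (2 ^ input_size xs)"
    using length_le_input_size[of xs] less_exp[of "input_size xs"] by (metis le_trans less_imp_le_nat of_nat_mono)
  then have "int (length xs) \<le> 2 ^ input_size xs" by simp
  moreover have "\<bar>xs ! nat (p - 1)\<bar> \<le> 2 ^ input_size xs" if "1 \<le> p" "p \<le> int (length xs)"
    using that by (intro abs_le_power_input_size nth_mem) auto
  ultimately show "\<bar>input_memory xs p\<bar> \<le> 2 ^ input_size xs"
    by (auto simp: input_memory_def)
qed

lemma encoded_supply_size:
  assumes "i < length (supplies I)" "j \<le> num_verts I"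
  shows "(\<Sum>x<j. input_size (encode_rat ((supplies I ! i) x))) \<le> input_size (encode_instance I)"
proof -
  let ?g = "\<lambda>s. concat (map (\<lambda>v. encode_rat (s v)) [0..<num_verts I])"
  have "(\<Sum>x<j. input_size (encode_rat ((supplies I ! i) x)))
      \<le> (\<Sum>x<num_verts I. input_size (encode_rat ((supplies I ! i) x)))"
    using assms by (intro sum_mono2) auto
  also have "\<dots> = input_size (?g (supplies I ! i))"
    by (simp add: input_size_concat interv_sum_list_conv_sum_set_nat atLeast0LessThan)
  also have "\<dots> \<le> (\<Sum>s\<leftarrow>supplies I. input_size (?g s))"
    using assms by (intro member_le_sum_list) auto
  also have "\<dots> \<le> input_size (encode_instance I)"
    unfolding encode_instance_def input_size_append input_size_concat by simp
  finally show ?thesis .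
qed

text \<open>The two sign units in the encoded size give the factor 4 that absorbs the sum.
  Multiplied over the vertices, these bounds turn a product into a sum of sizes.\<close>

lemma rat_size_bound:
  "\<bar>fst (quotient_of r)\<bar> + snd (quotient_of r) \<le> 2 ^ input_size (encode_rat r)"
proof -
  let ?a = "fst (quotient_of r)" and ?b = "snd (quotient_of r)"
  obtain a b where ab: "int_size ?a = Suc a" "int_size ?b = Suc b"
    using int_size_pos by (metis Suc_le_D One_nat_def)
  then have "\<bar>?a\<bar> < 2 ^ a" "\<bar>?b\<bar> < 2 ^ b" by (metis int_size_le_iff order_refl)+
  moreover have "(2::int) ^ a \<le> 2 ^ (a + b)" "(2::int) ^ b \<le> 2 ^ (a + b)"
    by (rule power_increasing; simp)+
  ultimately have "\<bar>?a\<bar> + ?b \<le> 2 * 2 ^ (a + b)" by linarith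
  also have "\<dots> \<le> 4 * 2 ^ (a + b)" by simp
  also have "\<dots> = 2 ^ input_size (encode_rat r)"
    by (simp add: input_size_def encode_rat_def ab)
  finally show ?thesis .
qed

section \<open>The program on an encoded symmetric di-tree\<close>

locale tree_instance =
  fixes I :: lomuf_instance
  assumes member: "I \<in> symmetric_di_tree_instances"
begin

abbreviation num :: "nat \<Rightarrow> nat \<Rightarrow> int" where
  "num i x \<equiv> fst (quotient_of ((supplies I ! i) x))"

abbreviation den :: "nat \<Rightarrow> nat \<Rightarrow> int" where
  "den i x \<equiv> snd (quotient_of ((supplies I ! i) x))"

abbreviation bits :: nat where
  "bits \<equiv> input_size (encode_instance I)"

lemma symmetric: "symmetric_di_tree (inst_graph I) (inst_cap I)"
  using member by (simp add: symmetric_di_tree_instances_def)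

sublocale tree: symmetric_tree "{..<num_verts I}" "set (arc_list I)"
  using symmetric_di_tree_tree[OF symmetric] by (simp add: inst_graph_def)

lemma verts_nonempty: "0 < num_verts I"
  using symmetric
  by (auto simp: symmetric_di_tree_def di_tree_def undirected_tree_def inst_graph_def lessThan_empty_iff)

text \<open>Every word has size at least 1, so it suffices to count words; one commodity contributes
  words for all vertices, and there is at least one vertex.\<close>

lemma counts_le_bits:
  "3 + length (arc_list I) \<le> bits" "length (supplies I) \<le> bits"
  "0 < length (supplies I) \<Longrightarrow> num_verts I \<le> bits"
proof -
  have len: "3 + 4 * length (arc_list I) + 2 * (num_verts I * length (supplies I)) \<le> bits"
    using length_le_input_size[of "encode_instance I"] by (simp add: length_encode_instance mult.assoc)
  then show "3 + length (arc_list I) \<le> bits" by simp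
  have "1 * length (supplies I) \<le> num_verts I * length (supplies I)"
    using verts_nonempty by (intro mult_le_mono1) simp
  with len show "length (supplies I) \<le> bits" by linarith
  assume "0 < length (supplies I)"
  then have "num_verts I * 1 \<le> num_verts I * length (supplies I)"
    by (intro mult_le_mono2) (simp add: Suc_le_eq)
  with len show "num_verts I \<le> bits" by linarith
qed

sublocale encoded_network "2 ^ bits" bits "num_verts I" "arc_list I" "length (supplies I)" num den
proof
  show "int bits \<le> 2 ^ bits"
    using less_exp[of bits] by (metis less_imp_le_nat of_nat_mono of_nat_numeral of_nat_power)
  have "int (num_verts I) \<in> set (encode_instance I)" by (simp add: encode_instance_def)
  from abs_le_power_input_size[OF this] show "int (num_verts I) \<le> 2 ^ bits" by simp
  show "x < num_verts I \<and> y < num_verts I" if "(x, y) \<in> set (arc_list I)" for x y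
    using tree.E_in_V[OF that] by simp
  show "0 < den i x" for i x by (rule quotient_of_denom_pos')
  show "(\<Prod>x<j. \<bar>num i x\<bar> + den i x) \<le> 2 ^ bits" if "i < length (supplies I)" "j \<le> num_verts I" for i j
  proof -
    \<comment> \<open>Each factor is at most 2 to the size of its encoding, and the exponents add up
      to part of the block of one commodity.\<close>
    have "(\<Prod>x<j. \<bar>num i x\<bar> + den i x) \<le> (\<Prod>x<j. 2 ^ input_size (encode_rat ((supplies I ! i) x)))"
      using rat_size_bound quotient_of_denom_pos' by (intro prod_mono) (simp add: order_less_imp_le)
    also have "\<dots> = 2 ^ (\<Sum>x<j. input_size (encode_rat ((supplies I ! i) x)))"
      by (simp add: power_sum)
    also have "\<dots> \<le> 2 ^ bits"
      using encoded_supply_size[OF that] by (intro power_increasing) auto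
    finally show ?thesis .
  qed
qed (use counts_le_bits in auto)

lemma input_ok_input_memory: "input_ok (input_memory (encode_instance I))"
proof -
  let ?xs = "encode_instance I"
  note len = length_encode_instance[of I]
  have cell: "input_memory ?xs (1 + int p) = ?xs ! p" if "p < length ?xs" for p
    using input_memory_nth[OF that] .
  have header: "?xs ! 0 = int (num_verts I)" "?xs ! 1 = int (length (arc_list I))"
    "?xs ! 2 = int (length (supplies I))"
    by (simp_all add: encode_instance_def)
  show ?thesis
    unfolding input_ok_def
  proof (intro conjI allI impI)
    show "input_memory ?xs 1 = int (num_verts I)" using cell[of 0] header len by simp
    show "input_memory ?xs 2 = int (length (arc_list I))" using cell[of 1] header len by simp
    show "input_memory ?xs 3 = int (length (supplies I))" using cell[of 2] header len by simp
  next
    fix j assume j: "j < length (arc_list I)"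
    then have "3 + 4 * j < length ?xs" "4 + 4 * j < length ?xs" using len by simp_all
    from cell[OF this(1)] cell[OF this(2)] nth_encode_arc[OF j]
    show "input_memory ?xs (4 + 4 * int j) = int (fst (arc_list I ! j))"
      and "input_memory ?xs (5 + 4 * int j) = int (snd (arc_list I ! j))"
      by simp_all
  next
    fix i x assume ix: "i < length (supplies I)" "x < num_verts I"
    let ?p = "\<lambda>r. 3 + 4 * length (arc_list I) + (2 * (i * num_verts I + x) + r)"
    have "i * num_verts I + x < Suc i * num_verts I" using ix by simp
    also have "\<dots> \<le> length (supplies I) * num_verts I" using ix by (intro mult_le_mono1) simp
    finally have "i * num_verts I + x < num_verts I * length (supplies I)" by (simp add: mult.commute)
    then have "?p r < length ?xs" if "r < 2" for r using len that by simp
    then have "input_memory ?xs (1 + int (?p r)) = encode_rat ((supplies I ! i) x) ! r" if "r < 2" for r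
      using cell nth_encode_supplies[OF ix that] that by presburger
    from this[of 0] this[of 1]
    show "input_memory ?xs (4 + 4 * int (length (arc_list I)) + 2 * (int i * int (num_verts I) + int x)) = num i x"
      and "input_memory ?xs (5 + 4 * int (length (arc_list I)) + 2 * (int i * int (num_verts I) + int x)) = den i x"
      by (simp_all add: encode_rat_def add.assoc)
  qed
qed

lemma inst_supplies_nth:
  "i < length (supplies I) \<Longrightarrow> (inst_supplies I ! i) x = real_of_int (num i x) / real_of_int (den i x)"
proof -
  assume i: "i < length (supplies I)"
  let ?r = "(supplies I ! i) x"
  have "?r = rat_of_int (num i x) / rat_of_int (den i x)"
    by (rule quotient_of_div) simp
  then have "real_of_rat ?r = real_of_rat (rat_of_int (num i x) / rat_of_int (den i x))" by simp
  then show ?thesis using i by (simp add: inst_supplies_def of_rat_divide)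
qed

lemma balance_neg_iff:
  assumes "i < length (supplies I)" "S \<subseteq> {..<num_verts I}"
  defines "w \<equiv> \<lambda>x. - (inst_supplies I ! i) x"
  shows "balance i S (num_verts I) < 0 \<longleftrightarrow> sum w ({..<num_verts I} - S) < sum w S"
proof -
  have "balance i S (num_verts I) = (\<Sum>x<num_verts I. (if x \<in> S then - w x else w x))"
    unfolding balance_def
    by (rule sum.cong) (simp_all add: w_def inst_supplies_nth[OF assms(1)])
  also have "\<dots> = (\<Sum>x\<in>{..<num_verts I} \<inter> S. - w x) + (\<Sum>x\<in>{..<num_verts I} \<inter> - S. w x)"
    by (simp add: sum.If_cases)
  also have "{..<num_verts I} \<inter> S = S" using assms(2) by blast
  also have "{..<num_verts I} \<inter> - S = {..<num_verts I} - S" by blast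
  finally show ?thesis by (auto simp: sum_negf)
qed

text \<open>Here the tree returns. If the default survived, no side is heavy, since sides are proper
  subsets of the vertices, and vertex 0 is a centroid; otherwise the smallest heavy side gives
  one.\<close>

lemma smallest_heavy_centroid:
  assumes i: "i < length (supplies I)" and heavy: "smallest_heavy i (length (arc_list I)) b c"
  shows "centroid {..<num_verts I} (set (arc_list I)) (\<lambda>x. - (inst_supplies I ! i) x) b"
proof -
  let ?V = "{..<num_verts I}" and ?E = "set (arc_list I)" and ?w = "\<lambda>x. - (inst_supplies I ! i) x"
  have side: "side ?E u v \<subseteq> ?V" if "(u, v) \<in> ?E" for u v
    using tree.side_subset tree.E_in_V[OF that] by blast
  have least: "c \<le> card (side ?E u v)"
    if uv: "(u, v) \<in> ?E" "sum ?w (?V - side ?E u v) < sum ?w (side ?E u v)" for u v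
  proof -
    obtain j where "j < length (arc_list I)" "arc_list I ! j = (u, v)"
      using uv(1) by (auto simp: in_set_conv_nth)
    then show ?thesis
      using heavy balance_neg_iff[OF i side[OF uv(1)]] uv(2) unfolding smallest_heavy_def by fastforce
  qed
  consider "c = num_verts I" "b = 0"
    | j where "j < length (arc_list I)" "balance i (tail_side j) (num_verts I) < 0"
      "b = fst (arc_list I ! j)" "c = card (tail_side j)"
    using heavy unfolding smallest_heavy_def by blast
  then show ?thesis
  proof cases
    case 1
    have "sum ?w (side ?E u 0) \<le> sum ?w (?V - side ?E u 0)" if "(u, 0) \<in> ?E" for u
    proof -
      have "0 \<notin> side ?E u 0" using tree.E_neq[OF that] by (rule avoided_notin_side)
      then have "side ?E u 0 \<subset> ?V" using side[OF that] verts_nonempty by blast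
      then have "card (side ?E u 0) < num_verts I" using psubset_card_mono[of ?V "side ?E u 0"] by simp
      then show ?thesis using least[OF that] 1 by linarith
    qed
    then show ?thesis using 1 verts_nonempty by (simp add: centroid_def)
  next
    case 2
    obtain u v where uv: "arc_list I ! j = (u, v)" by force
    then have E: "(u, v) \<in> ?E" using nth_mem[OF 2(1)] by simp
    have heavy': "sum ?w (?V - side ?E u v) < sum ?w (side ?E u v)"
      using balance_neg_iff[OF i side[OF E]] 2(2) uv by simp
    have "card (side ?E u v) \<le> card (side ?E x y)"
      if "(x, y) \<in> ?E" "sum ?w (?V - side ?E x y) < sum ?w (side ?E x y)" for x y
      using least[OF that] 2(4) uv by simp
    from tree.smallest_heavy_side_centroid[OF E heavy' this] show ?thesis
      using 2(3) uv by simp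
  qed
qed

lemma lomuf_program_correct:
  obtains t m vs where "exec lomuf_program (input_memory (encode_instance I)) t m"
    and "t \<le> steps bits lomuf_program * (bits + 2)"
    and "output_words m = map int vs" and "length vs = length (supplies I)"
    and "\<forall>i < length (supplies I).
      centroid {..<num_verts I} (set (arc_list I)) (\<lambda>x. - (inst_supplies I ! i) x) (vs ! i)"
proof -
  let ?k = "length (supplies I)"
  from wp_lomuf_program[OF bounded_input_memory input_ok_input_memory] obtain t m where
    run: "exec lomuf_program (input_memory (encode_instance I)) t m"
      "t \<le> steps bits lomuf_program * int_size (2 ^ bits)"
    and m: "m 0 = int ?k"
      "\<forall>i<?k. \<exists>b c. m (1 + int i) = int b \<and> smallest_heavy i (length (arc_list I)) b c"
    unfolding wp_def by blast
  \<comment> \<open>Every result cell holds some \<open>int b\<close>, so \<open>nat\<close> loses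
    nothing.\<close>
  define vs where "vs = map (\<lambda>i. nat (m (1 + int i))) [0..<?k]"
  \<comment> \<open>\<open>2 ^ bits\<close> has \<open>bits + 1\<close> binary digits, and the sign
    takes one more unit.\<close>
  have "int_size (2 ^ bits) \<le> Suc (Suc bits)" unfolding int_size_le_iff by simp
  then have "t \<le> steps bits lomuf_program * (bits + 2)"
    using run(2) by (metis add_2_eq_Suc' le_trans mult_le_mono2)
  moreover have "output_words m = map int vs"
  proof (rule nth_equalityI)
    show "length (output_words m) = length (map int vs)"
      by (simp add: output_words_def vs_def m)
    fix i assume "i < length (output_words m)"
    then have i: "i < ?k" by (simp add: output_words_def m)
    then have "\<exists>b. m (1 + int i) = int b" using m(2) by blast
    then show "output_words m ! i = map int vs ! i"
      using i by (auto simp: output_words_def vs_def m)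
  qed
  moreover have "centroid {..<num_verts I} (set (arc_list I)) (\<lambda>x. - (inst_supplies I ! i) x) (vs ! i)"
    if i: "i < ?k" for i
  proof -
    obtain b c where "m (1 + int i) = int b" "smallest_heavy i (length (arc_list I)) b c"
      using m(2) i by blast
    then show ?thesis using smallest_heavy_centroid[OF i] i by (simp add: vs_def)
  qed
  moreover have "length vs = ?k" by (simp add: vs_def)
  ultimately show ?thesis using that run(1) by blast
qed

end

theorem theorem7:
  shows "\<exists>P. polynomial_time_on P (encode_instance ` symmetric_di_tree_instances) \<and>
    (\<forall>I \<in> symmetric_di_tree_instances. \<exists>vs.
       outputs P (encode_instance I) (map int vs) \<and>
       length vs = length (inst_supplies I) \<and>
       set vs \<subseteq> pverts (inst_graph I) \<and>
       lomuf_value (inst_graph I) (inst_cap I) (inst_supplies I) vs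
         \<ge> 1 / 2 * lomuf_opt (inst_graph I) (inst_cap I) (inst_supplies I))"
proof (intro exI[of _ lomuf_program] conjI ballI)
  obtain B where B: "\<forall>s. steps s lomuf_program = poly B s" using steps_poly by blast
  show "polynomial_time_on lomuf_program (encode_instance ` symmetric_di_tree_instances)"
    unfolding polynomial_time_on_def
  \<comment> \<open>\<open>[:2, 1:]\<close> is the word length \<open>bits + 2\<close> as a
    polynomial in the input size.\<close>
  proof (intro exI[of _ "B * [:2, 1:]"] ballI)
    fix xs assume "xs \<in> encode_instance ` symmetric_di_tree_instances"
    then obtain I where "I \<in> symmetric_di_tree_instances" and xs: "xs = encode_instance I" by blast
    then interpret tree_instance I by unfold_locales
    obtain t m where "exec lomuf_program (input_memory xs) t m"
      "t \<le> steps (input_size xs) lomuf_program * (input_size xs + 2)"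
      unfolding xs by (rule lomuf_program_correct)
    then show "\<exists>t m. exec lomuf_program (input_memory xs) t m \<and> t \<le> poly (B * [:2, 1:]) (input_size xs)"
      using B by (intro exI[of _ t] exI[of _ m]) (simp add: algebra_simps)
  qed
next
  fix I assume I: "I \<in> symmetric_di_tree_instances"
  then interpret tree_instance I by unfold_locales
  obtain t m vs where run: "exec lomuf_program (input_memory (encode_instance I)) t m"
    "t \<le> steps bits lomuf_program * (bits + 2)" "output_words m = map int vs" and len: "length vs = length (supplies I)"
    and cent: "\<forall>i < length (supplies I).
      centroid {..<num_verts I} (set (arc_list I)) (\<lambda>x. - (inst_supplies I ! i) x) (vs ! i)"
    by (rule lomuf_program_correct)
  have len': "length (inst_supplies I) = length (supplies I)" by (simp add: inst_supplies_def)
  have "supply_vector (inst_graph I) s" if "s \<in> set (inst_supplies I)" for s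
    using I that by (simp add: symmetric_di_tree_instances_def well_formed_instance_def)
  then have "1 / 2 * lomuf_opt (inst_graph I) (inst_cap I) (inst_supplies I)
      \<le> lomuf_value (inst_graph I) (inst_cap I) (inst_supplies I) vs"
    using cent len len' by (intro centroids_half_optimal[OF symmetric]) (auto simp: inst_graph_def)
  moreover have "set vs \<subseteq> pverts (inst_graph I)"
    using cent len by (auto simp: inst_graph_def centroid_def in_set_conv_nth)
  ultimately show "\<exists>vs. outputs lomuf_program (encode_instance I) (map int vs) \<and>
       length vs = length (inst_supplies I) \<and> set vs \<subseteq> pverts (inst_graph I) \<and>
       lomuf_value (inst_graph I) (inst_cap I) (inst_supplies I) vs
         \<ge> 1 / 2 * lomuf_opt (inst_graph I) (inst_cap I) (inst_supplies I)"
    using run(1,3) len len' by (intro exI[of _ vs]) (auto simp: outputs_def)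
qed

end
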